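(* Let $G$ be a finite simple cubic graph, $\Pi$ a polyhedral embedding of $G$, and $G^e=G^e(\Pi)$. Suppose $G^e$ contains a butterfly one on vertices $t_0,t_{0'},t_1,t_2,t_3,t_4,t_{4'},t_5,t_{5'}$, and that the disjunctions of the two forks $(t_1,t_2,t_3,t_4,t_{4'})$ and $(t_3,t_2,t_1,t_0,t_{0'})$ (the latter having edges $t_3t_2,t_2t_1,t_1t_0,t_1t_{0'}$ and scaffold edges $[t_3t_0],[t_3t_{0'}]$) both cannot be solved. Then $G$ is isomorphic to the Petersen graph $P$, and the scaffold multiset of $G^e$ consists of exactly the pairs of non-adjacent vertices of $G$, each with multiplicity one (i.e. $\mathcal S=E(K_{10})\setminus E(P)$, all single).
   Context: An embedding of a graph in a surface without boundary is polyhedral if every facial walk is a cycle and any two distinct facial cycles intersect in either the empty set, a single vertex, or a single edge. A $\Pi$-facial subwalk is a walk formed by consecutive vertices of some $\Pi$-facial cycle (in either direction). The extended graph $G^e(\Pi)$ has vertex set $V(G)$ and edge set $E(G)$ together with a multiset $\mathcal S$ of scaffold edges: for distinct vertices $t_0,t_3$, $[t_0t_3]$ appears with multiplicity equal to the number of paths $(t_0t_1t_2t_3)$ of $G$ that are $\Pi$-facial subwalks. A fork $(a_1,a_2,a_3,a_4,a_{4'})$ in $G^e$ consists of five distinct vertices such that $a_1a_2,a_2a_3,a_3a_4,a_3a_{4'}$ are edges of $G$ and $[a_1a_4],[a_1a_{4'}]$ are scaffold edges; its disjunction can be solved if either every polyhedral embedding $\Pi'$ of $G$ with $G^e(\Pi')=G^e$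 has $(a_1a_2a_3a_4)$ as a $\Pi'$-facial subwalk, or every such $\Pi'$ has $(a_1a_2a_3a_{4'})$ as a $\Pi'$-facial subwalk; otherwise it cannot be solved. A butterfly one in $G^e$ consists of nine distinct vertices $t_0,t_{0'},t_1,t_2,t_3,t_4,t_{4'},t_5,t_{5'}$ such that $(t_0t_1t_2t_3t_4t_5t_0)$ and $(t_{0'}t_1t_2t_3t_{4'}t_{5'}t_{0'})$ are $6$-cycles of $G$ and $[t_1t_4],[t_1t_{4'}],[t_0t_3],[t_{0'}t_3]$ are scaffold edges. *)

theory Defs
  imports
    Graph_Theory.Graph_Theory
    "HOL-Combinatorics.Cycles"
    "HOL-Combinatorics.Orbits"
    "HOL-Library.Multiset"
begin

text \<open>
  A finite simple graph is a \<open>pair_graph\<close>: a finite loop-free digraph with a symmetric arc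
  relation, so that an edge \<open>uv\<close> is the pair of arcs \<open>(u,v)\<close>, \<open>(v,u)\<close> and the set of
  neighbours of \<open>v\<close> is \<open>parcs G `` {v}\<close>.
\<close>

definition cubic :: "'a pair_pre_digraph \<Rightarrow> bool" where
  "cubic G \<longleftrightarrow> (\<forall>v\<in>pverts G. out_degree (with_proj G) v = 3)"

text \<open>The cycle \<open>(p\<^sub>0 p\<^sub>1 \<dots> p\<^sub>k p\<^sub>0)\<close> is represented by the list \<open>[p\<^sub>0, p\<^sub>1, \<dots>, p\<^sub>k]\<close>.\<close>

definition vertex_cycle :: "('a, 'b) pair_pre_digraph_scheme \<Rightarrow> 'a list \<Rightarrow> bool" where
  "vertex_cycle G p \<longleftrightarrow> 3 \<le> length p \<and> distinct p \<and>
     (\<forall>i<length p. (p ! i, p ! (Suc i mod length p)) \<in> parcs G)"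

definition cycle_edges :: "'a list \<Rightarrow> 'a set set" where
  "cycle_edges p = {{p ! i, p ! (Suc i mod length p)} | i. i < length p}"

section \<open>Embeddings\<close>

text \<open>
  Cellular embeddings of a connected graph in (connected, closed, orientable or non-orientable)
  surfaces are given, up to homeomorphism, by embedding schemes: a cyclic ordering of the edges
  around every vertex and a signature on the edges. As the graphs are simple, the edges at \<open>v\<close>
  are represented by the neighbours of \<open>v\<close>. The signature of an edge is \<open>True\<close> for \<open>+1\<close>, i.e.
  when the local orientations at its ends agree along the edge, and \<open>False\<close> for \<open>-1\<close>.
\<close>

record 'a scheme =
  rotation :: "'a \<Rightarrow> 'a \<Rightarrow> 'a"
  signature :: "'a set \<Rightarrow> bool"

definition embedding :: "'a pair_pre_digraph \<Rightarrow> 'a scheme \<Rightarrow> bool" where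
  "embedding G \<phi> \<longleftrightarrow> Digraph_Component.connected (with_proj G) \<and>
     (\<forall>v\<in>pverts G. rotation \<phi> v permutes (parcs G `` {v}) \<and>
        (parcs G `` {v} \<noteq> {} \<longrightarrow> cyclic_on (rotation \<phi> v) (parcs G `` {v})))"

text \<open>
  Face traversal. In the state \<open>(v, w, s)\<close> the edge \<open>vw\<close> is about to be traversed from \<open>v\<close> to
  \<open>w\<close>, and \<open>s\<close> tells whether the local orientation is currently followed (\<open>True\<close>) or reversed.
  Traversing \<open>vw\<close> multiplies the mode by the signature; the next edge at \<open>w\<close> is the successor or
  the predecessor of \<open>wv\<close> accordingly.
\<close>

fun face_step :: "'a scheme \<Rightarrow> 'a \<times> 'a \<times> bool \<Rightarrow> 'a \<times> 'a \<times> bool" where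
  "face_step \<phi> (v, w, s) =
     (let s' = (s = signature \<phi> {v, w})
      in (w, if s' then rotation \<phi> w v else inv (rotation \<phi> w) v, s'))"

text \<open>
  The list \<open>support f x\<close> is one period \<open>[x, f x, f (f x), \<dots>]\<close> of the orbit of \<open>x\<close>. Since every
  initial state is admitted, each face occurs with every starting point and in both directions.
\<close>

definition facial_walks :: "'a pair_pre_digraph \<Rightarrow> 'a scheme \<Rightarrow> 'a list set" where
  "facial_walks G \<phi> = {map fst (support (face_step \<phi>) (v, w, s)) | v w s. (v, w) \<in> parcs G}"

text \<open>
  Facial cycles are compared and intersected as subgraphs, so that the lists describing the same
  cycle are identified, and two common vertices are allowed only as the ends of a common edge.
\<close>

definition polyhedral :: "'a pair_pre_digraph \<Rightarrow> 'a scheme \<Rightarrow> bool" where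
  "polyhedral G \<phi> \<longleftrightarrow> embedding G \<phi> \<and>
     (\<forall>W\<in>facial_walks G \<phi>. vertex_cycle G W) \<and>
     (\<forall>W\<in>facial_walks G \<phi>. \<forall>W'\<in>facial_walks G \<phi>. cycle_edges W \<noteq> cycle_edges W' \<longrightarrow>
        set W \<inter> set W' = {} \<or>
        (\<exists>v. set W \<inter> set W' = {v}) \<or>
        (\<exists>u v. set W \<inter> set W' = {u, v} \<and> cycle_edges W \<inter> cycle_edges W' = {{u, v}}))"

definition facial_subwalk :: "'a pair_pre_digraph \<Rightarrow> 'a scheme \<Rightarrow> 'a list \<Rightarrow> bool" where
  "facial_subwalk G \<phi> p \<longleftrightarrow>
     (\<exists>W\<in>facial_walks G \<phi>. \<exists>q\<in>{p, rev p}. \<exists>j.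
        q = map (\<lambda>i. W ! ((j + i) mod length W)) [0..<length q])"

section \<open>Extended graphs\<close>

record 'a ext_graph = "'a pair_pre_digraph" +
  scaffolds :: "'a set multiset"

text \<open>
  A path is the same as its reversal, so it is represented by \<open>P = {p, rev p}\<close>, and \<open>hd ` P\<close> is
  the set of its two ends.
\<close>

definition facial_three_paths :: "'a pair_pre_digraph \<Rightarrow> 'a scheme \<Rightarrow> 'a list set set" where
  "facial_three_paths G \<phi> = {{p, rev p} | p.
     length p = 4 \<and> distinct p \<and> successively (\<lambda>u v. (u, v) \<in> parcs G) p \<and>
     facial_subwalk G \<phi> p}"

definition extended_graph :: "'a pair_pre_digraph \<Rightarrow> 'a scheme \<Rightarrow> 'a ext_graph" where
  "extended_graph G \<phi> = \<lparr>pverts = pverts G, parcs = parcs G,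
     scaffolds = image_mset (\<lambda>P. hd ` P) (mset_set (facial_three_paths G \<phi>))\<rparr>"

definition fork :: "'a ext_graph \<Rightarrow> 'a \<Rightarrow> 'a \<Rightarrow> 'a \<Rightarrow> 'a \<Rightarrow> 'a \<Rightarrow> bool" where
  "fork X a1 a2 a3 a4 a4' \<longleftrightarrow> distinct [a1, a2, a3, a4, a4'] \<and>
     {a1, a2, a3, a4, a4'} \<subseteq> pverts X \<and>
     (a1, a2) \<in> parcs X \<and> (a2, a3) \<in> parcs X \<and> (a3, a4) \<in> parcs X \<and> (a3, a4') \<in> parcs X \<and>
     {a1, a4} \<in># scaffolds X \<and> {a1, a4'} \<in># scaffolds X"

definition disjunction_solvable ::
    "'a pair_pre_digraph \<Rightarrow> 'a ext_graph \<Rightarrow> 'a \<Rightarrow> 'a \<Rightarrow> 'a \<Rightarrow> 'a \<Rightarrow> 'a \<Rightarrow> bool" where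
  "disjunction_solvable G X a1 a2 a3 a4 a4' \<longleftrightarrow>
     (\<forall>\<phi>'. polyhedral G \<phi>' \<and> extended_graph G \<phi>' = X \<longrightarrow> facial_subwalk G \<phi>' [a1, a2, a3, a4]) \<or>
     (\<forall>\<phi>'. polyhedral G \<phi>' \<and> extended_graph G \<phi>' = X \<longrightarrow> facial_subwalk G \<phi>' [a1, a2, a3, a4'])"

definition butterfly_one ::
    "'a ext_graph \<Rightarrow>
     'a \<Rightarrow> 'a \<Rightarrow> 'a \<Rightarrow> 'a \<Rightarrow> 'a \<Rightarrow> 'a \<Rightarrow> 'a \<Rightarrow> 'a \<Rightarrow> 'a \<Rightarrow> bool" where
  "butterfly_one X t0 t0' t1 t2 t3 t4 t4' t5 t5' \<longleftrightarrow>
     distinct [t0, t0', t1, t2, t3, t4, t4', t5, t5'] \<and>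
     vertex_cycle X [t0, t1, t2, t3, t4, t5] \<and>
     vertex_cycle X [t0', t1, t2, t3, t4', t5'] \<and>
     {t1, t4} \<in># scaffolds X \<and> {t1, t4'} \<in># scaffolds X \<and>
     {t0, t3} \<in># scaffolds X \<and> {t0', t3} \<in># scaffolds X"

text \<open>The Petersen graph, as the Kneser graph on the two-element subsets of a five-element set.\<close>

definition petersen :: "nat set pair_pre_digraph" where
  "petersen = \<lparr>pverts = {A. A \<subseteq> {..<5} \<and> card A = 2},
     parcs = {(A, B). A \<subseteq> {..<5} \<and> card A = 2 \<and> B \<subseteq> {..<5} \<and> card B = 2 \<and> A \<inter> B = {}}\<rparr>"

end

(*
  In a cubic graph the two faces at an edge cd, taken together, contain exactly the two facial
  3-paths of a perfect matching between the other neighbours of c and of d; polyhedrality forbids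
  two faces to share more than one edge.  Hence, if the face through t1 t2 t3 is t0 t1 t2 t3 s, the
  scaffold edges from t1 and t3 to the neighbours s' of t3 and t0' of t1 off that face can only come
  from the faces t0 t1 t0' and s t3 s'.  These two then meet in t0' and s', so t0' s' is an edge.

  For s = t4 this gives t5' the four neighbours t0', t4', t0, t4, which is impossible.  So every
  embedding with the given extended graph is of the crossing kind s = t4' (or its mirror image
  t0' t1 t2 t3 t4), and since the disjunction is unsolvable both kinds occur, giving both edges
  t0' t4 and t0 t4'.  Three vertices t2, t5, t5' now miss one neighbour each.  The scaffold edge from
  t1 to the third neighbour of t5, read off one kind of embedding and realised in the other, forces
  the three missing neighbours to coincide.  This is the Petersen graph with its six pentagons.
*)
theory Submission
  imports Defs
begin

section \<open>Faces of a cubic polyhedral embedding\<close>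

fun state_edge :: "'a \<times> 'a \<times> bool \<Rightarrow> 'a set" where
  "state_edge (v, w, s) = {v, w}"

text \<open>The state that traverses the same edge of the same face backwards. Its mode is the
  negation of the mode with which \<open>(v, w, s)\<close> arrives at \<open>w\<close>.\<close>

fun reverse_state :: "'a scheme \<Rightarrow> 'a \<times> 'a \<times> bool \<Rightarrow> 'a \<times> 'a \<times> bool" where
  "reverse_state \<phi> (v, w, s) = (w, v, s \<noteq> signature \<phi> {v, w})"

definition face_edges :: "'a scheme \<Rightarrow> 'a \<times> 'a \<times> bool \<Rightarrow> 'a set set" where
  "face_edges \<phi> x = range (\<lambda>i. state_edge ((face_step \<phi> ^^ i) x))"

text \<open>As edge sets, the facial walks that differ only in starting point or direction become
  one face.\<close>

definition faces :: "'a pair_pre_digraph \<Rightarrow> 'a scheme \<Rightarrow> 'a set set set" where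
  "faces G \<phi> = cycle_edges ` facial_walks G \<phi>"

lemma reverse_state_involution [simp]: "reverse_state \<phi> (reverse_state \<phi> x) = x"
  by (cases x) (auto simp: insert_commute)

lemma state_edge_reverse [simp]: "state_edge (reverse_state \<phi> x) = state_edge x"
  by (cases x) auto

lemma fst_face_step: "fst (face_step \<phi> x) = fst (snd x)"
  by (cases x) (auto simp: Let_def)

lemma state_edge_fst: "state_edge x = {fst x, fst (face_step \<phi> x)}"
  by (cases x) (auto simp: Let_def)

locale cubic_polyhedral = pair_graph G for G :: "'a pair_pre_digraph" +
  fixes \<phi> :: "'a scheme"
  assumes cubic: "cubic G" and polyhedral: "polyhedral G \<phi>"
begin

abbreviation step where "step \<equiv> face_step \<phi>"
abbreviation rev_st where "rev_st \<equiv> reverse_state \<phi>"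

definition states :: "('a \<times> 'a \<times> bool) set" where
  "states = {(v, w, s). (v, w) \<in> parcs G}"

lemma arc_sym: "(v, w) \<in> parcs G \<Longrightarrow> (w, v) \<in> parcs G"
  using sym_arcs by (auto simp: symmetric_def sym_def)

lemma states_iff [simp]: "(v, w, s) \<in> states \<longleftrightarrow> (v, w) \<in> parcs G"
  by (simp add: states_def)

lemma finite_states: "finite states"
proof -
  have "states \<subseteq> (\<lambda>((v, w), s). (v, w, s)) ` (parcs G \<times> UNIV)"
    by (force simp: states_def)
  then show ?thesis
    by (rule finite_subset) (simp add: pair_finite_arcs)
qed

section \<open>Rotations at a vertex of degree three\<close>

lemma card_neighbours: "v \<in> pverts G \<Longrightarrow> card (parcs G `` {v}) = 3"
proof -
  assume "v \<in> pverts G"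
  then have "card (out_arcs (with_proj G) v) = 3"
    using cubic by (auto simp: cubic_def out_degree_def)
  moreover have "out_arcs (with_proj G) v = Pair v ` (parcs G `` {v})"
    by (auto simp: out_arcs_def)
  ultimately show ?thesis
    by (simp add: card_image inj_on_def)
qed

lemma embedding: "embedding G \<phi>"
  using polyhedral by (simp add: polyhedral_def)

lemma rotation_permutes: "v \<in> pverts G \<Longrightarrow> rotation \<phi> v permutes (parcs G `` {v})"
  using embedding by (auto simp: embedding_def)

lemma rotation_cyclic: "v \<in> pverts G \<Longrightarrow> cyclic_on (rotation \<phi> v) (parcs G `` {v})"
  using embedding card_neighbours[of v] by (fastforce simp: embedding_def)

lemma rotation_in: "(v, u) \<in> parcs G \<Longrightarrow> (v, rotation \<phi> v u) \<in> parcs G"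
  using permutes_in_image[OF rotation_permutes, of v u] in_arcsD1[of v u] by auto

lemma inv_rotation_in: "(v, u) \<in> parcs G \<Longrightarrow> (v, inv (rotation \<phi> v) u) \<in> parcs G"
  using permutes_in_image[OF permutes_inv[OF rotation_permutes], of v u] in_arcsD1[of v u] by auto

lemma inv_rotation [simp]:
  "v \<in> pverts G \<Longrightarrow> inv (rotation \<phi> v) (rotation \<phi> v u) = u"
  "v \<in> pverts G \<Longrightarrow> rotation \<phi> v (inv (rotation \<phi> v) u) = u"
  using permutes_inverses[OF rotation_permutes] by auto

text \<open>A set containing \<open>u\<close> and closed under the rotation contains the orbit of
  \<open>u\<close>, which is the whole neighbourhood and has three elements. This excludes fixed
  points and 2-cycles, so the rotation is a 3-cycle.\<close>

lemma neighbours_rotation: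
  assumes "(v, u) \<in> parcs G"
  shows "parcs G `` {v} = {u, rotation \<phi> v u, rotation \<phi> v (rotation \<phi> v u)}"
    and "rotation \<phi> v (rotation \<phi> v (rotation \<phi> v u)) = u"
    and "distinct [u, rotation \<phi> v u, rotation \<phi> v (rotation \<phi> v u)]"
proof -
  let ?r = "rotation \<phi> v" and ?N = "parcs G `` {v}"
  have v: "v \<in> pverts G" using assms by (rule in_arcsD1)
  have inj: "?r a = ?r b \<longleftrightarrow> a = b" for a b
    using inv_rotation(1)[OF v] by metis
  have N: "?N = orbit ?r u"
    using orbit_cyclic_eq3[OF rotation_cyclic[OF v], of u] assms by simp
  have min: "3 \<le> card T" if "finite T" "u \<in> T" "\<And>a. a \<in> T \<Longrightarrow> ?r a \<in> T" for T
  proof -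
    have "a \<in> T" if "a \<in> orbit ?r u" for a
      using that by induct (use \<open>u \<in> T\<close> \<open>\<And>a. a \<in> T \<Longrightarrow> ?r a \<in> T\<close> in auto)
    then have "?N \<subseteq> T" using N by auto
    then have "card ?N \<le> card T" using \<open>finite T\<close> by (rule card_mono[rotated])
    then show ?thesis using card_neighbours[OF v] by simp
  qed
  have 1: "?r u \<noteq> u" using min[of "{u}"] by auto
  have 2: "?r (?r u) \<noteq> u"
  proof
    assume "?r (?r u) = u"
    then show False using min[of "{u, ?r u}"] 1 by auto
  qed
  show d: "distinct [u, ?r u, ?r (?r u)]" using 1 2 inj by auto
  have sub: "{u, ?r u, ?r (?r u)} \<subseteq> ?N" using assms rotation_in by blast
  show "?N = {u, ?r u, ?r (?r u)}"
    using card_subset_eq[OF _ sub] card_neighbours[OF v] d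
    by (metis card.infinite card_3_iff distinct_length_2_or_more zero_neq_numeral)
  moreover have "?r (?r (?r u)) \<in> ?N" using assms rotation_in by blast
  ultimately show "?r (?r (?r u)) = u" using inj 1 2 by (metis insert_iff singletonD)
qed

lemma inv_rotation_eq:
  assumes "(v, u) \<in> parcs G"
  shows "inv (rotation \<phi> v) u = rotation \<phi> v (rotation \<phi> v u)"
  using neighbours_rotation(2)[OF assms] inv_rotation(1)[OF in_arcsD1[OF assms]] by metis

section \<open>Face traversal as an injective map on finitely many states\<close>

lemma step_in: "x \<in> states \<Longrightarrow> step x \<in> states"
  using rotation_in inv_rotation_in arc_sym by (cases x) (auto simp: Let_def)

lemma rev_in: "x \<in> states \<Longrightarrow> rev_st x \<in> states"
  using arc_sym by (cases x) auto

lemma funpow_in: "x \<in> states \<Longrightarrow> (step ^^ i) x \<in> states"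
  by (induct i) (auto simp: step_in)

text \<open>Reversal turns \<open>step\<close> into its inverse: walking on from the reversed
  successor leads to the reversed state. Injectivity of \<open>step\<close> follows.\<close>

lemma step_reverse: "x \<in> states \<Longrightarrow> step (rev_st (step x)) = rev_st x"
proof (cases x)
  case (fields v w s)
  assume "x \<in> states"
  then have "w \<in> pverts G" using fields in_arcsD2 by auto
  then show ?thesis using fields by (auto simp: Let_def insert_commute)
qed

lemma step_inj: "x \<in> states \<Longrightarrow> y \<in> states \<Longrightarrow> step x = step y \<Longrightarrow> x = y"
  using step_reverse reverse_state_involution by metis

lemma funpow_inj:
  "x \<in> states \<Longrightarrow> y \<in> states \<Longrightarrow> (step ^^ i) x = (step ^^ i) y \<Longrightarrow> x = y"
proof (induct i)
  case (Suc i)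
  then show ?case using step_inj[OF funpow_in funpow_in, of x y i i] by simp
qed simp

text \<open>Finitely many states force two iterates to agree, and injectivity cancels the common
  initial part.\<close>

lemma step_periodic:
  assumes "x \<in> states"
  obtains n where "0 < n" "(step ^^ n) x = x"
proof -
  have "\<not> inj (\<lambda>i. (step ^^ i) x)"
    using finite_subset[OF _ finite_states, of "range (\<lambda>i. (step ^^ i) x)"] funpow_in[OF assms]
    by (auto dest: finite_imageD)
  then obtain i j where "i < j" and eq: "(step ^^ i) x = (step ^^ j) x"
    by (metis (no_types, lifting) injI linorder_neqE_nat)
  then have "(step ^^ i) x = (step ^^ i) ((step ^^ (j - i)) x)"
    by (metis add_diff_inverse_nat comp_apply funpow_add less_imp_not_less)
  then have "(step ^^ (j - i)) x = x"
    using funpow_inj assms funpow_in by metis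
  then show thesis using that[of "j - i"] \<open>i < j\<close> by simp
qed

section \<open>Facial walks and the edge sets of faces\<close>

abbreviation walk where "walk x \<equiv> map fst (support step x)"

lemma least_power_step:
  assumes "x \<in> states"
  shows "(step ^^ least_power step x) x = x" "0 < least_power step x"
proof -
  obtain n where "0 < n" "(step ^^ n) x = x" using step_periodic assms by blast
  then show "(step ^^ least_power step x) x = x" "0 < least_power step x"
    using least_powerI[of n step x] by auto
qed

text \<open>Replaces positions modulo the length of a facial walk by iterates of
  \<open>step\<close>.\<close>

lemma walk_nth_mod:
  assumes "x \<in> states"
  shows "walk x ! (i mod length (walk x)) = fst ((step ^^ i) x)"
  using least_power_step[OF assms] funpow_mod_eq[of "least_power step x" step x i] by simp

lemma walk_facial: "x \<in> states \<Longrightarrow> walk x \<in> facial_walks G \<phi>"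
  by (cases x) (auto simp: facial_walks_def)

lemma facial_walkE:
  assumes "W \<in> facial_walks G \<phi>"
  obtains x where "x \<in> states" "W = walk x"
  using assms by (auto simp: facial_walks_def)

lemma cycle_edges_walk:
  assumes "x \<in> states"
  shows "cycle_edges (walk x) = face_edges \<phi> x"
proof -
  let ?n = "length (walk x)" and ?q = "\<lambda>i. (step ^^ i) x"
  have n: "0 < ?n" using least_power_step[OF assms] by simp
  have edge: "{walk x ! (i mod ?n), walk x ! (Suc i mod ?n)} = state_edge (?q i)" for i
    using walk_nth_mod[OF assms, of i] walk_nth_mod[OF assms, of "Suc i"]
    by (simp add: state_edge_fst[of _ \<phi>])
  have q: "?q i = ?q (i mod ?n)" for i
    using least_power_step[OF assms] funpow_mod_eq[of "least_power step x" step x i] by simp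
  show ?thesis
  proof (intro equalityI subsetI)
    fix e assume "e \<in> cycle_edges (walk x)"
    then obtain i where "i < ?n" "e = {walk x ! i, walk x ! (Suc i mod ?n)}"
      by (auto simp: cycle_edges_def)
    then show "e \<in> face_edges \<phi> x"
      using edge[of i] by (auto simp: face_edges_def)
  next
    fix e assume "e \<in> face_edges \<phi> x"
    then obtain i where "e = state_edge (?q i)" by (auto simp: face_edges_def)
    also have "\<dots> = {walk x ! (i mod ?n), walk x ! (Suc (i mod ?n) mod ?n)}"
      using edge[of "i mod ?n"] q[of i] by simp
    finally show "e \<in> cycle_edges (walk x)"
      using n by (auto simp: cycle_edges_def intro!: exI[of _ "i mod ?n"])
  qed
qed

lemma face_edges_step:
  assumes "x \<in> states"
  shows "face_edges \<phi> (step x) = face_edges \<phi> x"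
proof -
  obtain n where n: "0 < n" "(step ^^ n) x = x" using step_periodic assms by blast
  have shift: "(step ^^ i) (step x) = (step ^^ Suc i) x" for i
    by (simp add: funpow_swap1)
  \<comment> \<open>After a full period the state \<open>x\<close> recurs, so it is also reached
    from \<open>step x\<close>. As \<open>n\<close> is positive, the subtraction only removes the
    step already taken.\<close>
  have "(step ^^ i) x = (step ^^ (i + n - 1)) (step x)" for i
  proof -
    have "(step ^^ (i + n - 1)) (step x) = (step ^^ (i + n)) x"
      using shift[of "i + n - 1"] n(1) by simp
    then show ?thesis using n(2) by (simp add: funpow_add)
  qed
  then show ?thesis
    unfolding face_edges_def using shift by (auto simp: image_iff simp del: funpow.simps) metis+
qed

lemma face_edges_funpow: "x \<in> states \<Longrightarrow> face_edges \<phi> ((step ^^ i) x) = face_edges \<phi> x"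
  by (induct i) (auto simp: face_edges_step funpow_in)

lemma state_edge_in_face: "state_edge x \<in> face_edges \<phi> x"
  unfolding face_edges_def by (rule range_eqI[of _ _ 0]) simp

text \<open>By \<open>step_reverse\<close>, the reversals of all states on the orbit of
  \<open>x\<close> lie on one orbit, run through backwards. This gives one inclusion; the involution
  gives the other.\<close>

lemma face_edges_reverse:
  assumes "x \<in> states"
  shows "face_edges \<phi> (rev_st x) = face_edges \<phi> x"
proof -
  have sub: "face_edges \<phi> x \<subseteq> face_edges \<phi> (rev_st x)" if "x \<in> states" for x
  proof
    fix e assume "e \<in> face_edges \<phi> x"
    then obtain i where e: "e = state_edge ((step ^^ i) x)" by (auto simp: face_edges_def)
    have "face_edges \<phi> (rev_st ((step ^^ i) x)) = face_edges \<phi> (rev_st x)"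
    proof (induct i)
      case (Suc i)
      let ?y = "(step ^^ i) x"
      have y: "?y \<in> states" using funpow_in that .
      have "face_edges \<phi> (rev_st (step ?y)) = face_edges \<phi> (step (rev_st (step ?y)))"
        using face_edges_step rev_in step_in y by simp
      then show ?case using Suc step_reverse[OF y] by simp
    qed simp
    then show "e \<in> face_edges \<phi> (rev_st x)"
      using state_edge_in_face[of "rev_st ((step ^^ i) x)"] e by simp
  qed
  show ?thesis
    using sub[OF assms] sub[OF rev_in[OF assms]] by simp
qed

section \<open>Consequences of facial walks being cycles\<close>

lemma walk_vertex_cycle: "x \<in> states \<Longrightarrow> vertex_cycle G (walk x)"
  using polyhedral walk_facial by (auto simp: polyhedral_def)

text \<open>A facial cycle visits no vertex twice within a period, so along one orbit the current
  vertex determines the state.\<close>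

lemma orbit_fst_inj:
  assumes "x \<in> states" "fst ((step ^^ i) x) = fst ((step ^^ j) x)"
  shows "(step ^^ i) x = (step ^^ j) x"
proof -
  define W where "W = walk x"
  have W: "distinct W" "0 < length W"
    using walk_vertex_cycle[OF assms(1)] by (auto simp: vertex_cycle_def W_def)
  have "W ! (i mod length W) = W ! (j mod length W)"
    using assms(2) walk_nth_mod[OF assms(1)] unfolding W_def by simp
  then have "i mod length W = j mod length W"
    using nth_eq_iff_index_eq[OF W(1)] mod_less_divisor[OF W(2)] by blast
  moreover have "(step ^^ k) x = (step ^^ (k mod length W)) x" for k
    using least_power_step[OF assms(1)] funpow_mod_eq[of "least_power step x" step x k]
    by (simp add: W_def)
  ultimately show ?thesis by (metis (no_types))
qed

lemma faces_eq: "faces G \<phi> = face_edges \<phi> ` states"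
proof -
  have "facial_walks G \<phi> = walk ` states"
    using walk_facial facial_walkE by blast
  then show ?thesis
    unfolding faces_def using cycle_edges_walk by (simp add: image_image)
qed

text \<open>Any edge of a face can be taken as the start of its traversal, in either direction,
  thanks to reversal.\<close>

lemma faceE_edge:
  assumes "f \<in> faces G \<phi>" "{u, v} \<in> f"
  obtains s where "(u, v) \<in> parcs G" "f = face_edges \<phi> (u, v, s)"
proof -
  obtain x where x: "x \<in> states" "f = face_edges \<phi> x" using assms faces_eq by auto
  then obtain i where i: "{u, v} = state_edge ((step ^^ i) x)"
    using assms(2) by (auto simp: face_edges_def)
  obtain a b s where y: "(step ^^ i) x = (a, b, s)" by (cases "(step ^^ i) x")
  have st: "(a, b, s) \<in> states" using funpow_in[OF x(1), of i] y by simp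
  have f: "f = face_edges \<phi> (a, b, s)" using face_edges_funpow[OF x(1), of i] y x(2) by simp
  consider "u = a" "v = b" | "u = b" "v = a"
    using i y by (auto simp: doubleton_eq_iff)
  then show thesis
  proof cases
    case 1
    then show ?thesis using that st f by auto
  next
    case 2
    then show ?thesis
      using that[of "s \<noteq> signature \<phi> {a, b}"] st f face_edges_reverse[OF st] arc_sym by auto
  qed
qed

abbreviation next_vertex where "next_vertex u v s \<equiv> fst (snd (step (u, v, s)))"

lemma next_vertex_eq:
  assumes "(u, v) \<in> parcs G"
  shows "next_vertex u v s = (if s = signature \<phi> {u, v} then rotation \<phi> v u
    else rotation \<phi> v (rotation \<phi> v u))"
  using inv_rotation_eq[of v u] arc_sym[OF assms] by (simp add: Let_def)

text \<open>The cycle passes \<open>v\<close> once, so its only edges at \<open>v\<close> are the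
  one that enters and the one that leaves.\<close>

lemma face_edges_neighbours:
  assumes "(u, v) \<in> parcs G"
  shows "{v, w} \<in> face_edges \<phi> (u, v, s) \<longleftrightarrow> w = u \<or> w = next_vertex u v s"
proof
  let ?x = "(u, v, s)"
  have x: "?x \<in> states" using assms by simp
  assume "{v, w} \<in> face_edges \<phi> ?x"
  then obtain i where i: "{v, w} = state_edge ((step ^^ i) ?x)"
    by (auto simp: face_edges_def)
  obtain a b s' where y: "(step ^^ i) ?x = (a, b, s')" by (cases "(step ^^ i) ?x")
  consider "a = v" "b = w" | "a = w" "b = v"
    using i y by (auto simp: doubleton_eq_iff)
  then show "w = u \<or> w = next_vertex u v s"
  proof cases
    case 1
    then have "(step ^^ i) ?x = (step ^^ 1) ?x"
      using y by (intro orbit_fst_inj[OF x]) (simp add: fst_face_step del: face_step.simps)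
    then have "step ?x = (v, w, s')" using y 1 by (simp del: face_step.simps)
    then show ?thesis by (simp del: face_step.simps)
  next
    case 2
    \<comment> \<open>Here the edge is traversed towards \<open>v\<close>; the following state
      starts at \<open>v\<close>, as \<open>step ?x\<close> does, and injectivity of
      \<open>step\<close> then identifies the predecessors.\<close>
    then have "(step ^^ Suc i) ?x = (step ^^ 1) ?x"
      using y by (intro orbit_fst_inj[OF x]) (simp add: fst_face_step del: face_step.simps)
    then have "(step ^^ i) ?x = ?x"
      using step_inj[OF funpow_in[OF x, of i] x] by simp
    then show ?thesis using y 2 by (simp del: face_step.simps)
  qed
next
  let ?x = "(u, v, s)"
  have x: "?x \<in> states" using assms by simp
  have "state_edge (step ?x) = {v, next_vertex u v s}"
    by (metis fst_conv fst_face_step snd_conv state_edge.simps prod.collapse)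
  moreover assume "w = u \<or> w = next_vertex u v s"
  ultimately show "{v, w} \<in> face_edges \<phi> ?x"
    using state_edge_in_face[of ?x] state_edge_in_face[of "step ?x"] face_edges_step[OF x]
    by (auto simp: insert_commute)
qed

lemma face_at_vertex:
  assumes "f \<in> faces G \<phi>" "{u, v} \<in> f"
  obtains w where "w \<noteq> u" "(v, w) \<in> parcs G" "\<And>z. {v, z} \<in> f \<longleftrightarrow> z = u \<or> z = w"
proof -
  obtain s where s: "(u, v) \<in> parcs G" "f = face_edges \<phi> (u, v, s)"
    using faceE_edge assms by blast
  have vu: "(v, u) \<in> parcs G" using arc_sym s(1) .
  show thesis
  proof (rule that[of "next_vertex u v s"])
    show "next_vertex u v s \<noteq> u" "(v, next_vertex u v s) \<in> parcs G"
      using neighbours_rotation[OF vu] rotation_in vu next_vertex_eq[OF s(1), of s] by auto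
    show "{v, z} \<in> f \<longleftrightarrow> z = u \<or> z = next_vertex u v s" for z
      unfolding s(2) by (rule face_edges_neighbours[OF s(1)])
  qed
qed

text \<open>The two modes of traversing \<open>uv\<close> turn at \<open>v\<close> to the two other
  neighbours, one each; hence exactly one mode turns to \<open>w\<close>.\<close>

lemma face_through_angle:
  assumes "(v, u) \<in> parcs G" "(v, w) \<in> parcs G" "u \<noteq> w"
  shows "\<exists>!f. f \<in> faces G \<phi> \<and> {u, v} \<in> f \<and> {v, w} \<in> f"
proof -
  have uv: "(u, v) \<in> parcs G" using arc_sym assms(1) .
  have w: "w = rotation \<phi> v u \<or> w = rotation \<phi> v (rotation \<phi> v u)"
    and d: "rotation \<phi> v u \<noteq> rotation \<phi> v (rotation \<phi> v u)"
    using neighbours_rotation[OF assms(1)] assms(2,3) by auto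
  \<comment> \<open>The mode for which the turn at \<open>v\<close> leads to \<open>w\<close>: it
    agrees with the signature exactly when \<open>w\<close> is the rotation successor of
    \<open>u\<close>.\<close>
  define s where "s = ((w = rotation \<phi> v u) = signature \<phi> {u, v})"
  have nv: "next_vertex u v s' = w \<longleftrightarrow> s' = s" for s'
    using next_vertex_eq[OF uv, of s'] w d by (auto simp: s_def)
  show ?thesis
  proof (rule ex1I[of _ "face_edges \<phi> (u, v, s)"], intro conjI)
    show "face_edges \<phi> (u, v, s) \<in> faces G \<phi>" using uv faces_eq by auto
    show "{u, v} \<in> face_edges \<phi> (u, v, s)" using state_edge_in_face[of "(u, v, s)"] by simp
    show "{v, w} \<in> face_edges \<phi> (u, v, s)" 
      using nv[of s] by (simp add: face_edges_neighbours[OF uv] del: face_step.simps)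
  next
    fix f assume f: "f \<in> faces G \<phi> \<and> {u, v} \<in> f \<and> {v, w} \<in> f"
    then obtain s' where s': "f = face_edges \<phi> (u, v, s')" using faceE_edge by blast
    then have "next_vertex u v s' = w" 
      using face_edges_neighbours[OF uv, of w s'] f assms(3) by (simp del: face_step.simps)
    then show "f = face_edges \<phi> (u, v, s)" using nv s' by simp
  qed
qed

lemma face_edge_arc: "f \<in> faces G \<phi> \<Longrightarrow> {u, v} \<in> f \<Longrightarrow> (u, v) \<in> parcs G"
  using faceE_edge by blast

section \<open>Intersections of faces, and facial paths with three edges\<close>

lemma set_eq_Union_cycle_edges:
  assumes "W \<in> facial_walks G \<phi>"
  shows "set W = \<Union> (cycle_edges W)"
proof -
  obtain x where x: "x \<in> states" "W = walk x" using facial_walkE assms .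
  then have n: "length W > 0" using least_power_step[OF x(1)] by simp
  show ?thesis
  proof (intro equalityI subsetI)
    fix a assume "a \<in> set W"
    then obtain i where "i < length W" "a = W ! i" by (auto simp: in_set_conv_nth)
    then show "a \<in> \<Union> (cycle_edges W)" unfolding cycle_edges_def by blast
  qed (use n in \<open>auto simp: cycle_edges_def\<close>)
qed

text \<open>Two common vertices rule out an empty or one-vertex intersection, so polyhedrality
  leaves only a common edge, and its ends must be \<open>a\<close> and \<open>b\<close>.\<close>

lemma faces_meet:
  assumes "f \<in> faces G \<phi>" "g \<in> faces G \<phi>" "f \<noteq> g" "a \<noteq> b"
    "a \<in> \<Union> f" "a \<in> \<Union> g" "b \<in> \<Union> f" "b \<in> \<Union> g"
  shows "{a, b} \<in> f \<and> {a, b} \<in> g \<and> \<Union> f \<inter> \<Union> g = {a, b}"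
proof -
  obtain W W' where W: "W \<in> facial_walks G \<phi>" "f = cycle_edges W"
    and W': "W' \<in> facial_walks G \<phi>" "g = cycle_edges W'"
    using assms by (auto simp: faces_def)
  have "\<Union> f \<inter> \<Union> g = {} \<or> (\<exists>v. \<Union> f \<inter> \<Union> g = {v}) \<or>
      (\<exists>u v. \<Union> f \<inter> \<Union> g = {u, v} \<and> f \<inter> g = {{u, v}})"
    using polyhedral W W' \<open>f \<noteq> g\<close> set_eq_Union_cycle_edges
    unfolding polyhedral_def by metis
  moreover have ab: "a \<in> \<Union> f \<inter> \<Union> g" "b \<in> \<Union> f \<inter> \<Union> g"
    using assms(5-) by blast+
  ultimately show ?thesis
  proof (elim disjE exE conjE)
    fix u v assume eq: "\<Union> f \<inter> \<Union> g = {u, v}" "f \<inter> g = {{u, v}}"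
    then have "a \<in> {u, v}" "b \<in> {u, v}" using ab by simp_all
    then have "{a, b} = {u, v}" using assms(4) by blast
    then show ?thesis using eq by blast
  qed (use ab assms(4) in simp_all)
qed

text \<open>Removes indices and directions from facial subwalks. For the converse, a face traversed
  from \<open>a\<close> to \<open>b\<close> must leave \<open>b\<close> by its other edge, to
  \<open>c\<close>, and then \<open>c\<close> by its other edge, to \<open>d\<close>.\<close>

lemma facial_three_path_iff:
  assumes "distinct [a, b, c, d]"
  shows "facial_subwalk G \<phi> [a, b, c, d] \<longleftrightarrow>
    (\<exists>f\<in>faces G \<phi>. {a, b} \<in> f \<and> {b, c} \<in> f \<and> {c, d} \<in> f)"
proof
  assume "facial_subwalk G \<phi> [a, b, c, d]"
  then obtain W q j where W: "W \<in> facial_walks G \<phi>" and q_in: "q \<in> {[a, b, c, d], rev [a, b, c, d]}"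
    and q_eq: "q = map (\<lambda>i. W ! ((j + i) mod length W)) [0..<length q]"
    unfolding facial_subwalk_def by (elim bexE exE) (rule that)
  from q_in have q_cases: "q = [a, b, c, d] \<or> q = rev [a, b, c, d]" by simp
  have len: "length q = 4" using q_cases by auto
  have q: "q ! i = W ! ((j + i) mod length W)" if "i < 4" for i
    using arg_cong[OF q_eq, of "\<lambda>l. l ! i"] that len by simp
  obtain x where x: "x \<in> states" "W = walk x" using facial_walkE W .
  have "{W ! ((j + i) mod length W), W ! ((j + Suc i) mod length W)} \<in> cycle_edges W" for i
  proof -
    have "{fst ((step ^^ (j + i)) x), fst ((step ^^ (j + Suc i)) x)} \<in> face_edges \<phi> x"
      by (auto simp: face_edges_def state_edge_fst[of _ \<phi>] simp del: face_step.simps)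
    then show ?thesis
      unfolding x(2) cycle_edges_walk[OF x(1)] walk_nth_mod[OF x(1)] .
  qed
  from this[of 0] this[of 1] this[of 2]
  have "{q ! 0, q ! 1} \<in> cycle_edges W" "{q ! 1, q ! 2} \<in> cycle_edges W"
    "{q ! 2, q ! 3} \<in> cycle_edges W"
    using q[of 0] q[of 1] q[of 2] q[of 3] by (simp_all add: numeral_2_eq_2 numeral_3_eq_3)
  then have "{a, b} \<in> cycle_edges W \<and> {b, c} \<in> cycle_edges W \<and> {c, d} \<in> cycle_edges W"
    using q_cases by (auto simp: numeral_2_eq_2 numeral_3_eq_3 insert_commute)
  then show "\<exists>f\<in>faces G \<phi>. {a, b} \<in> f \<and> {b, c} \<in> f \<and> {c, d} \<in> f"
    using W by (auto simp: faces_def)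
next
  assume "\<exists>f\<in>faces G \<phi>. {a, b} \<in> f \<and> {b, c} \<in> f \<and> {c, d} \<in> f"
  then obtain f where f: "f \<in> faces G \<phi>" "{a, b} \<in> f" "{b, c} \<in> f" "{c, d} \<in> f" by blast
  obtain s where s: "(a, b) \<in> parcs G" "f = face_edges \<phi> (a, b, s)" using faceE_edge f(1,2) .
  let ?x = "(a, b, s)"
  have x: "?x \<in> states" using s by simp
  have "next_vertex a b s = c" using f(3) face_edges_neighbours[OF s(1)] s(2) assms by auto
  then obtain s' where s': "step ?x = (b, c, s')"
    by (metis fst_conv fst_face_step prod.collapse snd_conv)
  then have bc: "(b, c) \<in> parcs G" and f': "f = face_edges \<phi> (b, c, s')"
    using step_in[OF x] face_edges_step[OF x] s(2) by (simp_all del: face_step.simps)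
  have "next_vertex b c s' = d" using f(4) face_edges_neighbours[OF bc] f' assms by auto
  then have "fst ((step ^^ Suc (Suc (Suc 0))) ?x) = d" "fst ((step ^^ Suc (Suc 0)) ?x) = c"
    "fst ((step ^^ Suc 0) ?x) = b"
    using s' by (simp_all add: fst_face_step del: face_step.simps)
  then have "[a, b, c, d] = map (\<lambda>i. fst ((step ^^ i) ?x)) [0..<4]"
    by (simp add: numeral_eq_Suc upt_rec del: face_step.simps)
  also have "\<dots> = map (\<lambda>i. walk ?x ! ((0 + i) mod length (walk ?x))) [0..<length [a, b, c, d]]"
  proof -
    have "length [a, b, c, d] = 4" by simp
    then show ?thesis unfolding add_0 walk_nth_mod[OF x] by (rule ssubst) (rule refl)
  qed
  finally show "facial_subwalk G \<phi> [a, b, c, d]"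
    unfolding facial_subwalk_def
    by (intro bexI[OF _ walk_facial[OF x]] bexI[OF _ insertI1] exI)
qed

end

section \<open>Butterflies in systems of faces\<close>

text \<open>First-order incidence axioms, with \<open>on f u v\<close> for "the edge
  \<open>uv\<close> lies on the face \<open>f\<close>". In \<open>on_meet\<close> and
  \<open>on_meet3\<close> the primed variables only witness that a vertex lies on a face.\<close>

locale cubic_faces =
  fixes adj :: "'a \<Rightarrow> 'a \<Rightarrow> bool" and on :: "'f \<Rightarrow> 'a \<Rightarrow> 'a \<Rightarrow> bool"
  assumes adj_sym: "adj u v \<Longrightarrow> adj v u"
    and adj_irrefl: "\<not> adj v v"
    and adj_third: "adj v a \<Longrightarrow> adj v b \<Longrightarrow> a \<noteq> b \<Longrightarrow> \<exists>c. adj v c \<and> c \<noteq> a \<and> c \<noteq> b"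
    and adj_fourth: "adj v a \<Longrightarrow> adj v b \<Longrightarrow> adj v c \<Longrightarrow> distinct [a, b, c] \<Longrightarrow>
      adj v d \<Longrightarrow> d = a \<or> d = b \<or> d = c"
    and on_sym: "on f u v \<Longrightarrow> on f v u"
    and on_adj: "on f u v \<Longrightarrow> adj u v"
    and on_next: "on f v u \<Longrightarrow> \<exists>w. w \<noteq> u \<and> on f v w"
    and on_two: "on f v a \<Longrightarrow> on f v b \<Longrightarrow> on f v c \<Longrightarrow> a = b \<or> a = c \<or> b = c"
    and angle_face: "adj v u \<Longrightarrow> adj v w \<Longrightarrow> u \<noteq> w \<Longrightarrow> \<exists>f. on f v u \<and> on f v w"
    and angle_unique: "on f v u \<Longrightarrow> on f v w \<Longrightarrow> on g v u \<Longrightarrow> on g v w \<Longrightarrow> u \<noteq> w \<Longrightarrow> f = g"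
    and on_meet: "on f a a' \<Longrightarrow> on g a a'' \<Longrightarrow> on f b b' \<Longrightarrow> on g b b'' \<Longrightarrow> a \<noteq> b \<Longrightarrow> f \<noteq> g \<Longrightarrow>
      on f a b \<and> on g a b"
    and on_meet3: "on f a a' \<Longrightarrow> on g a a'' \<Longrightarrow> on f b b' \<Longrightarrow> on g b b'' \<Longrightarrow> on f c c' \<Longrightarrow> on g c c'' \<Longrightarrow>
      distinct [a, b, c] \<Longrightarrow> f = g"
begin

lemma on_irrefl: "\<not> on f v v"
  using on_adj adj_irrefl by blast

lemma on_either:
  assumes "on f v a" "adj v a" "adj v b" "adj v c" "distinct [a, b, c]"
  shows "on f v b \<or> on f v c"
  using on_next[OF assms(1)] adj_fourth[OF assms(2-5)] on_adj by blast

text \<open>\<open>F\<close> runs \<open>t0 t1 t2 t3 s\<close>, and \<open>g\<close> carries a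
  facial path from \<open>t1\<close> to the neighbour \<open>s'\<close> of \<open>t3\<close> off
  \<open>F\<close>. All ways in which \<open>g\<close> can start are compared with \<open>F\<close>
  and with the other face at \<open>t2 t3\<close>. The last two alternatives that remain are
  excluded only by using the mirror-image path as well.\<close>

lemma remote_face:
  assumes dist: "distinct [t0, t0', t1, t2, t3, s, s']" "x \<noteq> t1" "x \<noteq> t3"
    and adj: "adj t1 t0" "adj t1 t0'" "adj t1 t2" "adj t2 t3" "adj t2 x" "adj t3 s" "adj t3 s'"
    and F: "on F t0 t1" "on F t1 t2" "on F t2 t3" "on F t3 s"
    and g: "on g t1 a" "on g a b" "on g b s'" "distinct [t1, a, b, s']"
  shows "on g t1 t0' \<and>
    (on g t1 t0 \<and> on g t0 b \<or> on g t1 t0 \<and> on g t0' b \<or>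
     x = s' \<and> on g t1 t2 \<and> on g t2 x \<and> on g t0' b)"
proof -
  have adj': "adj t2 t1" "adj t3 t2" using adj adj_sym by auto
  have "x \<noteq> t2" using adj(5) adj_irrefl by blast
  have a: "a = t0 \<or> a = t0' \<or> a = t2"
    using adj_fourth[OF adj(1-3)] on_adj[OF g(1)] dist by auto
  \<comment> \<open>The second face at \<open>t2 t3\<close>; it runs
    \<open>x t2 t3 s'\<close>.\<close>
  obtain h where h: "on h t2 x" "on h t2 t3"
    using angle_face[OF adj(5,4)] dist by blast
  have hF: "h \<noteq> F"
    using on_two[of F t2 t1 t3 x] F h on_sym dist by auto
  have "on h t3 s \<or> on h t3 s'"
    using on_either[OF on_sym[OF h(2)] adj'(2) adj(6,7)] dist by auto
  then have h': "on h t3 s'"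
    using angle_unique[of h t3 t2 s F] h F hF on_sym dist by auto
  have gF: "on g t1 t2 \<Longrightarrow> on g t1 t0 \<Longrightarrow> g = F"
    using angle_unique[of g t1 t2 t0 F] F on_sym dist by auto
  \<comment> \<open>Otherwise \<open>F\<close> and \<open>h\<close> would share the three vertices
    \<open>t2\<close>, \<open>t3\<close>, \<open>s'\<close>.\<close>
  have F_s': "g \<noteq> F"
    using on_meet3[of F t2 t1 h t3 t3 t2 t2 s' b t3] hF F h h' on_sym g dist by auto
  have gh: "g \<noteq> h" if "on g t2 t1"
    using on_two[of h t2 t1 x t3] that h dist by auto
  from a show ?thesis
  proof (elim disjE)
    assume a: "a = t0"
    then have "on g t1 t0'"
      using on_either[of g t1 t0 t2 t0'] adj g gF F_s' dist by auto
    then show ?thesis using a g by auto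
  next
    assume a: "a = t0'"
    consider "on g t1 t0" | "on g t1 t2"
      using on_either[of g t1 t0' t0 t2] adj g a dist by auto
    then show ?thesis
    proof cases
      case 1
      then show ?thesis using a g by auto
    next
      case 2
      have "\<not> on g t2 t3"
        using angle_unique[of g t2 t1 t3 F] 2 F F_s' on_sym dist by auto
      then have x: "on g t2 x"
        using on_either[of g t2 t1 x t3] 2 adj adj' on_sym dist by auto
      \<comment> \<open>Both \<open>g\<close> and \<open>h\<close> contain \<open>t2\<close>,
        \<open>x\<close> and \<open>s'\<close>, too many for distinct faces unless two of these
        coincide.\<close>
      have "x = s'"
      proof (rule ccontr)
        assume "x \<noteq> s'"
        then show False
          using on_meet3[of g t2 t1 h t3 x t2 t2 s' b t3] gh 2 x h h' g on_sym dist \<open>x \<noteq> t2\<close> by auto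
      qed
      then show ?thesis using 2 x a g by auto
    qed
  next
    assume a: "a = t2"
    have "\<not> on g t2 t3"
      using angle_unique[of g t2 t1 t3 F] a g F F_s' on_sym dist by auto
    moreover have "b = t1 \<or> b = t3 \<or> b = x"
      using adj_fourth[of t2 t1 t3 x b] adj adj' on_adj a g dist by auto
    ultimately have "b = x" using a g by auto
    moreover have "x \<noteq> s'" using g(3) \<open>b = x\<close> on_irrefl by blast
    ultimately show ?thesis
      using on_meet3[of g t2 t1 h t3 x t2 t2 s' b t3] gh a h h' g on_sym dist \<open>x \<noteq> t2\<close> by auto
  qed
qed

text \<open>\<open>remote_face\<close> applies from both ends of \<open>t1 t2 t3\<close>. The faces
  \<open>g\<close> and \<open>h\<close> both contain \<open>t0'\<close> and \<open>s'\<close>, so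
  these are joined by a common edge. Two edges at \<open>t0'\<close> and at \<open>s'\<close> are
  then known on each face, which turns \<open>g\<close> into the pentagon
  \<open>t1 t0 b s' t0'\<close> and \<open>h\<close> into \<open>t3 s d t0' s'\<close>.\<close>

lemma opposite_pentagons:
  assumes dist: "distinct [t0, t0', t1, t2, t3, s, s']"
    and adj: "adj t1 t0" "adj t1 t0'" "adj t1 t2" "adj t2 t3" "adj t3 s" "adj t3 s'"
    and F: "on F t0 t1" "on F t1 t2" "on F t2 t3" "on F t3 s"
    and g: "on g t1 a" "on g a b" "on g b s'" "distinct [t1, a, b, s']"
    and h: "on h t3 c" "on h c d" "on h d t0'" "distinct [t3, c, d, t0']"
  shows "adj t0' s'" "b \<noteq> t3" "b \<noteq> t0'" "d \<noteq> t1" "d \<noteq> s'"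
    "on g t1 t0'" "on g t1 t0" "on g t0 b" "on g s' t0'"
    "on h t3 s'" "on h t3 s" "on h s d" "on h s' t0'"
proof -
  obtain x where x: "adj t2 x" "x \<noteq> t1" "x \<noteq> t3"
    using adj_third[of t2 t1 t3] adj adj_sym dist by auto
  have G: "on g t1 t0' \<and>
    (on g t1 t0 \<and> on g t0 b \<or> on g t1 t0 \<and> on g t0' b \<or>
     x = s' \<and> on g t1 t2 \<and> on g t2 x \<and> on g t0' b)"
    using remote_face[of t0 t0' t1 t2 t3 s s' x F g a b] assms x by blast
  have H: "on h t3 s' \<and>
    (on h t3 s \<and> on h s d \<or> on h t3 s \<and> on h s' d \<or>
     x = t0' \<and> on h t3 t2 \<and> on h t2 x \<and> on h s' d)"
    using remote_face[of s s' t3 t2 t1 t0 t0' x F h c d] assms x adj_sym on_sym by auto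
  have s'_nt1: "\<not> adj s' t1" "\<not> adj t3 t0'" "\<not> adj t1 t3"
    using adj_fourth[of t1 t0 t0' t2] adj_fourth[of t3 t2 s s'] adj adj_sym dist by auto
  have gh: "g \<noteq> h"
  \<comment> \<open>If \<open>g = h\<close>, the exceptional alternatives give three edges of this
    face at \<open>t2\<close>. Without them it shares \<open>t0\<close>, \<open>t1\<close>,
    \<open>t3\<close> with \<open>F\<close>, hence equals \<open>F\<close>, which then has three
    edges at \<open>t1\<close>.\<close>
  proof
    assume gh: "g = h"
    then have "\<not> on g t1 t2"
    proof (intro notI)
      assume "on g t1 t2"
      then have "x = s'" "on g t2 s'" using G on_two[of g t1 t0' t2 t0] dist by auto
      moreover have "on g s' t3" using H gh on_sym by auto
      ultimately have "b = t3 \<or> b = t2" using on_two[of g s' t2 t3 b] g on_sym dist by auto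
      moreover have "on g t0' b" using G \<open>on g t1 t2\<close> on_two[of g t1 t0' t2 t0] dist by auto
      ultimately have "b = t2" using s'_nt1(2) on_adj[OF on_sym] by blast
      then show False using \<open>on g t0' b\<close> on_two[of g t2 t1 s' t0'] \<open>on g t1 t2\<close> \<open>on g t2 s'\<close> on_sym dist
        by auto
    qed
    moreover have "\<not> on h t3 t2"
    proof (intro notI)
      assume "on h t3 t2"
      then have "x = t0'" "on h t2 t0'" using H on_two[of h t3 s' t2 s] dist by auto
      moreover have "on h t0' t1" using G gh on_sym by auto
      ultimately have "d = t1 \<or> d = t2" using on_two[of h t0' t2 t1 d] h on_sym dist by auto
      moreover have "on h s' d" using H \<open>on h t3 t2\<close> on_two[of h t3 s' t2 s] dist by auto
      ultimately have "d = t2" using s'_nt1(1) on_adj by blast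
      then show False using \<open>on h s' d\<close> on_two[of h t2 t3 s' t0'] \<open>on h t3 t2\<close> \<open>on h t2 t0'\<close> on_sym dist
        by auto
    qed
    ultimately have "on g t1 t0" "on g t3 s" using G H gh by auto
    then have "g = F"
      using on_meet3[of g t1 t0 F t0 t3 s s t0 t1 t1] F on_sym dist by auto
    then show False using on_two[of F t1 t0 t0' t2] G F on_sym \<open>on g t1 t0\<close> dist by auto
  qed
  have t0'_s': "on g t0' s'" "on h t0' s'"
    using on_meet[of g t0' t1 h d s' b t3] G H g h gh on_sym dist by auto
  have b: "\<not> on g t0' b"
    using on_two[of g t0' t1 s' b] t0'_s' G g on_sym dist by auto
  have d: "\<not> on h s' d"
    using on_two[of h s' t3 t0' d] t0'_s' H h on_sym dist by auto
  show "adj t0' s'" using t0'_s' on_adj by blast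
  show "on g t1 t0'" "on g t1 t0" "on g t0 b" using G b by auto
  show "on h t3 s'" "on h t3 s" "on h s d" using H d by auto
  show "on g s' t0'" "on h s' t0'" using t0'_s' on_sym by auto
  show "b \<noteq> t3" using \<open>on g t0 b\<close> on_adj adj_fourth[of t3 t2 s s' t0] adj adj_sym dist by auto
  show "b \<noteq> t0'"
    using \<open>on g t0 b\<close> on_two[of g t0' t1 s' t0] t0'_s' \<open>on g t1 t0'\<close> on_sym dist by auto
  show "d \<noteq> t1" using \<open>on h s d\<close> on_adj adj_fourth[of t1 t0 t0' t2 s] adj adj_sym dist by auto
  show "d \<noteq> s'"
    using \<open>on h s d\<close> on_two[of h s' t3 t0' s] t0'_s' \<open>on h t3 s'\<close> on_sym dist by auto
qed

section \<open>Facial paths and scaffold edges in terms of incidence\<close>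

lemma third_neighbour:
  assumes "adj v a" "adj v b" "a \<noteq> b"
  obtains c where "adj v c" "c \<noteq> a" "c \<noteq> b"
  using adj_third assms by blast

definition facial where
  "facial a b c d \<longleftrightarrow> distinct [a, b, c, d] \<and> (\<exists>f. on f a b \<and> on f b c \<and> on f c d)"

definition scaffold where
  "scaffold a d \<longleftrightarrow> (\<exists>b c. facial a b c d)"

lemma scaffoldE:
  assumes "scaffold a d"
  obtains f b c where "on f a b" "on f b c" "on f c d" "distinct [a, b, c, d]"
  using assms by (auto simp: scaffold_def facial_def)

lemma facialE:
  assumes "facial a b c d"
  obtains f where "on f a b" "on f b c" "on f c d"
  using assms by (auto simp: facial_def)

lemma facial_cases:
  assumes "adj a b" "adj b c" "adj c d" "adj c d'" "distinct [a, b, c, d, d']"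
  shows "facial a b c d \<or> facial a b c d'"
proof -
  obtain f where f: "on f b a" "on f b c"
    using angle_face[of b a c] assms adj_sym by auto
  then have "on f c d \<or> on f c d'"
    using on_either[of f c b d d'] assms adj_sym on_sym by auto
  then show ?thesis using f on_sym assms(5) by (auto simp: facial_def)
qed

end

section \<open>The faces forced by a butterfly\<close>

locale butterfly_faces = cubic_faces adj on
  for adj :: "'a \<Rightarrow> 'a \<Rightarrow> bool" and on :: "'f \<Rightarrow> 'a \<Rightarrow> 'a \<Rightarrow> bool" +
  fixes t0 t0' t1 t2 t3 t4 t4' t5 t5' :: 'a
  assumes dist: "distinct [t0, t0', t1, t2, t3, t4, t4', t5, t5']"
    and adj: "adj t1 t0" "adj t1 t0'" "adj t1 t2" "adj t2 t3" "adj t3 t4" "adj t3 t4'"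
      "adj t4 t5" "adj t4' t5'" "adj t5 t0" "adj t5' t0'"
    and scaffolds: "scaffold t1 t4" "scaffold t1 t4'" "scaffold t3 t0" "scaffold t3 t0'"
begin

lemma no_straight_face:
  assumes F: "on F t0 t1" "on F t1 t2" "on F t2 t3"
  shows "\<not> on F t3 t4"
proof
  assume F4: "on F t3 t4"
  obtain g a b where g: "on g t1 a" "on g a b" "on g b t4'" "distinct [t1, a, b, t4']"
    using scaffoldE[OF scaffolds(2)] .
  obtain h c d where h: "on h t3 c" "on h c d" "on h d t0'" "distinct [t3, c, d, t0']"
    using scaffoldE[OF scaffolds(4)] .
  have "distinct [t0, t0', t1, t2, t3, t4, t4']" using dist by auto
  note P = opposite_pentagons[OF this adj(1-6) F F4 g h]
  \<comment> \<open>With the new edge \<open>t0' t4'\<close>, the vertices \<open>t4'\<close> and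
    \<open>t0'\<close> have all their neighbours known, and \<open>t5'\<close> is the only one left
    for \<open>b\<close> and for \<open>d\<close>.\<close>
  have b: "b = t5'"
    using adj_fourth[of t4' t3 t5' t0' b] adj P(1-3) dist adj_sym on_adj[OF g(3)] by auto
  have d: "d = t5'"
    using adj_fourth[of t0' t1 t5' t4' d] adj P(1,4,5) dist adj_sym on_adj[OF h(3)] by auto
  have "adj t5' t0" "adj t5' t4" "adj t5' t4'"
    using P b d adj adj_sym on_adj by blast+
  then show False
    using adj_fourth[of t5' t0' t4' t0 t4] adj dist by auto
qed

text \<open>In the crossing case, \<open>opposite_pentagons\<close> with \<open>s = t4'\<close> and
  \<open>s' = t4\<close> leaves \<open>t5\<close> for \<open>b\<close> and \<open>t5'\<close> for
  \<open>d\<close>.\<close>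

lemma pentagons:
  assumes F: "on F t0 t1" "on F t1 t2" "on F t2 t3" "on F t3 t4'"
  obtains g h where "adj t0' t4"
    "on g t1 t0'" "on g t1 t0" "on g t0 t5" "on g t5 t4" "on g t4 t0'"
    "on h t3 t4" "on h t3 t4'" "on h t4' t5'" "on h t5' t0'" "on h t4 t0'"
proof -
  obtain g a b where g: "on g t1 a" "on g a b" "on g b t4" "distinct [t1, a, b, t4]"
    using scaffoldE[OF scaffolds(1)] .
  obtain h c d where h: "on h t3 c" "on h c d" "on h d t0'" "distinct [t3, c, d, t0']"
    using scaffoldE[OF scaffolds(4)] .
  have "distinct [t0, t0', t1, t2, t3, t4', t4]" using dist by auto
  note P = opposite_pentagons[OF this adj(1-4,6,5) F g h]
  have b: "b = t5"
    using adj_fourth[of t4 t3 t5 t0' b] adj P(1-3) dist adj_sym on_adj[OF g(3)] by auto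
  have d: "d = t5'"
    using adj_fourth[of t0' t1 t5' t4 d] adj P(1,4,5) dist adj_sym on_adj[OF h(3)] by auto
  show thesis
    using that[of g h] P g h b d by auto
qed

text \<open>Each face is followed from vertex to vertex: of the two possible turns, one forms an
  angle that already belongs to another face. With both crossing edges present this closes
  \<open>F\<close> and yields \<open>k\<close>, \<open>l\<close>, \<open>m\<close> up to the third
  neighbours \<open>x\<close>, \<open>r\<close>, \<open>r'\<close> of \<open>t2\<close>,
  \<open>t5\<close>, \<open>t5'\<close>.\<close>

lemma outer_faces:
  assumes F: "on F t0 t1" "on F t1 t2" "on F t2 t3" "on F t3 t4'"
    and t0_t4': "adj t0 t4'"
    and x: "adj t2 x" "x \<noteq> t1" "x \<noteq> t3"
    and r: "adj t5 r" "r \<noteq> t0" "r \<noteq> t4"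
    and r': "adj t5' r'" "r' \<noteq> t0'" "r' \<noteq> t4'"
  obtains g h k l m where "adj t0' t4" "on F t4' t0"
    "on g t1 t0'" "on g t1 t0" "on g t0 t5" "on g t5 t4" "on g t4 t0'"
    "on h t3 t4" "on h t3 t4'" "on h t4' t5'" "on h t5' t0'" "on h t4 t0'"
    "on k x t2" "on k t2 t1" "on k t1 t0'" "on k t0' t5'" "on k t5' r'"
    "on l x t2" "on l t2 t3" "on l t3 t4" "on l t4 t5" "on l t5 r"
    "on m r t5" "on m t5 t0" "on m t0 t4'" "on m t4' t5'" "on m t5' r'" "k \<noteq> l"
proof -
  obtain g h where t0'_t4: "adj t0' t4"
    and g: "on g t1 t0'" "on g t1 t0" "on g t0 t5" "on g t5 t4" "on g t4 t0'"
    and h: "on h t3 t4" "on h t3 t4'" "on h t4' t5'" "on h t5' t0'" "on h t4 t0'"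
    using pentagons[OF F] .
  note sym = adj adj[THEN adj_sym] t0_t4' t0'_t4 adj_sym[OF t0_t4'] adj_sym[OF t0'_t4]
  note gs = g g[THEN on_sym] and hs = h h[THEN on_sym] and Fs = F F[THEN on_sym]
  have Fg: "F \<noteq> g" using on_two[of g t1 t0 t0' t2] gs Fs dist by auto
  have "on F t0 t5 \<or> on F t0 t4'"
    using on_either[of F t0 t1 t5 t4'] Fs sym dist by auto
  \<comment> \<open>A turn to \<open>t5\<close> would give \<open>F\<close> the angle
    \<open>t1 t0 t5\<close> of \<open>g\<close>.\<close>
  then have F0: "on F t0 t4'"
    using angle_unique[of F t0 t1 t5 g] gs Fs Fg dist by auto
  obtain m where m: "on m t0 t5" "on m t0 t4'"
    using angle_face[of t0 t5 t4'] sym dist by auto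
  have mF: "m \<noteq> F" using on_two[of F t0 t1 t5 t4'] m F0 Fs dist by auto
  have mg: "m \<noteq> g" using on_two[of g t0 t1 t5 t4'] m gs dist by auto
  have "on m t4' t3 \<or> on m t4' t5'"
    using on_either[of m t4' t0 t3 t5'] m on_sym sym dist by auto
  then have m5': "on m t4' t5'"
    using angle_unique[of F t4' t3 t0 m] mF m F0 Fs on_sym dist by auto
  have mh: "m \<noteq> h" using on_two[of h t4' t5' t3 t0] m hs on_sym dist by auto
  have "on m t5 t4 \<or> on m t5 r"
    using on_either[of m t5 t0 t4 r] m on_sym sym r dist by auto
  then have mr: "on m t5 r"
    using angle_unique[of m t5 t0 t4 g] m mg gs on_sym dist by auto
  have "on m t5' t0' \<or> on m t5' r'"
    using on_either[of m t5' t4' t0' r'] m5' on_sym sym r' dist by auto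
  then have mr': "on m t5' r'"
    using angle_unique[of m t5' t4' t0' h] m5' mh hs on_sym dist by auto
  obtain l where l: "on l t4 t3" "on l t4 t5"
    using angle_face[of t4 t3 t5] sym dist by auto
  have lh: "l \<noteq> h" using on_two[of h t4 t3 t0' t5] l hs dist by auto
  have lg: "l \<noteq> g" using on_two[of g t4 t3 t0' t5] l gs dist by auto
  have lF: "l \<noteq> F" using on_two[of F t3 t2 t4' t4] l Fs on_sym dist by auto
  have "on l t3 t2 \<or> on l t3 t4'"
    using on_either[of l t3 t4 t2 t4'] l on_sym sym dist by auto
  then have l2: "on l t3 t2"
    using angle_unique[of l t3 t4 t4' h] l lh hs on_sym dist by auto
  have "on l t2 t1 \<or> on l t2 x"
    using on_either[of l t2 t3 t1 x] l2 on_sym sym x dist by auto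
  then have lx: "on l t2 x"
    using angle_unique[of l t2 t3 t1 F] l2 lF Fs on_sym dist by auto
  have "on l t5 t0 \<or> on l t5 r"
    using on_either[of l t5 t4 t0 r] l on_sym sym r dist by auto
  then have lr: "on l t5 r"
    using angle_unique[of l t5 t4 t0 g] l lg gs on_sym dist by auto
  obtain k where k: "on k t0' t1" "on k t0' t5'"
    using angle_face[of t0' t1 t5'] sym dist by auto
  have kg: "k \<noteq> g" using on_two[of g t0' t1 t5' t4] k gs dist by auto
  have kh: "k \<noteq> h" using on_two[of h t0' t1 t5' t4] k hs dist by auto
  have kF: "k \<noteq> F" using on_two[of F t1 t2 t0 t0'] k Fs on_sym dist by auto
  have "on k t1 t0 \<or> on k t1 t2"
    using on_either[of k t1 t0' t0 t2] k on_sym sym dist by auto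
  then have k2: "on k t1 t2"
    using angle_unique[of k t1 t0' t0 g] k kg gs on_sym dist by auto
  have "on k t2 t3 \<or> on k t2 x"
    using on_either[of k t2 t1 t3 x] k2 on_sym sym x dist by auto
  then have kx: "on k t2 x"
    using angle_unique[of k t2 t1 t3 F] k2 kF Fs on_sym dist by auto
  have "on k t5' t4' \<or> on k t5' r'"
    using on_either[of k t5' t0' t4' r'] k on_sym sym r' dist by auto
  then have kr': "on k t5' r'"
    using angle_unique[of k t5' t0' t4' h] k kh hs on_sym dist by auto
  have kl: "k \<noteq> l"
    using on_two[of k t2 t1 x t3] k2 kx l2 on_sym x dist by auto
  show thesis
    by (rule that[of g h k l m])
      (use t0'_t4 F0 g h k k2 kx kr' l l2 lx lr m m5' mr mr' kl on_sym in auto)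
qed


text \<open>Exchanging primed and unprimed vertices yields another butterfly. There
  \<open>no_straight_face\<close> forbids a face \<open>t0' t1 t2 t3 t4'\<close>, so the face must
  come from \<open>t0\<close>.\<close>

lemma facial_crossing:
  assumes "facial t1 t2 t3 t4'"
  obtains F where "on F t0 t1" "on F t1 t2" "on F t2 t3" "on F t3 t4'"
proof -
  interpret swapped: butterfly_faces adj on t0' t0 t1 t2 t3 t4' t4 t5' t5
    using dist adj scaffolds by unfold_locales auto
  obtain F where F: "on F t1 t2" "on F t2 t3" "on F t3 t4'"
    using facialE[OF assms] .
  have "on F t1 t0 \<or> on F t1 t0'"
    using on_either[of F t1 t2 t0 t0'] F adj dist by auto
  then have "on F t1 t0"
    using swapped.no_straight_face[of F] F on_sym by blast
  then show thesis using that F on_sym by blast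
qed

text \<open>The face \<open>k\<close> of \<open>outer_faces\<close> runs
  \<open>t1 t0' t5' r'\<close>. Only the resulting scaffold edge can be carried over to another
  embedding with the same extended graph.\<close>

lemma scaffold_third:
  assumes F: "on F t0 t1" "on F t1 t2" "on F t2 t3" "on F t3 t4'"
    and t0_t4': "adj t0 t4'" and r': "adj t5' r'" "r' \<noteq> t0'" "r' \<noteq> t4'"
  shows "scaffold t1 r'"
proof -
  obtain x where x: "adj t2 x" "x \<noteq> t1" "x \<noteq> t3"
    using third_neighbour[of t2 t1 t3] adj adj_sym dist by auto
  obtain r where r: "adj t5 r" "r \<noteq> t0" "r \<noteq> t4"
    using third_neighbour[of t5 t0 t4] adj adj_sym dist by auto
  obtain k where k: "on k t1 t0'" "on k t0' t5'" "on k t5' r'"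
    using outer_faces[OF F t0_t4' x r r'] by metis
  have "r' \<noteq> t1"
    using adj_fourth[of t1 t0 t0' t2 t5'] adj adj_sym r' dist by auto
  then show ?thesis
    unfolding scaffold_def facial_def
    using k r' on_irrefl dist by (intro exI[of _ t0'] exI[of _ t5']) auto
qed

text \<open>The scaffold edge from \<open>t1\<close> to \<open>r\<close> is the outside information.
  Going through the facial paths that could realise it gives \<open>r = r'\<close>; then
  \<open>k\<close> and \<open>l\<close> share \<open>t2\<close>, \<open>x\<close> and
  \<open>r\<close>, so \<open>r = x\<close>.\<close>

lemma petersen_faces:
  assumes F: "on F t0 t1" "on F t1 t2" "on F t2 t3" "on F t3 t4'"
    and t0_t4': "adj t0 t4'"
    and r: "adj t5 r" "r \<noteq> t0" "r \<noteq> t4" and t1_r: "scaffold t1 r"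
  obtains g h k l m where "adj t0' t4" "adj t2 r" "adj t5' r"
    "r \<notin> {t0, t0', t1, t2, t3, t4, t4', t5, t5'}" "on F t4' t0"
    "on g t1 t0'" "on g t1 t0" "on g t0 t5" "on g t5 t4" "on g t4 t0'"
    "on h t3 t4" "on h t3 t4'" "on h t4' t5'" "on h t5' t0'" "on h t4 t0'"
    "on k r t2" "on k t2 t1" "on k t1 t0'" "on k t0' t5'" "on k t5' r"
    "on l r t2" "on l t2 t3" "on l t3 t4" "on l t4 t5" "on l t5 r"
    "on m r t5" "on m t5 t0" "on m t0 t4'" "on m t4' t5'" "on m t5' r"
proof -
  obtain x where x: "adj t2 x" "x \<noteq> t1" "x \<noteq> t3"
    using third_neighbour[of t2 t1 t3] adj adj_sym dist by auto
  obtain r' where r': "adj t5' r'" "r' \<noteq> t0'" "r' \<noteq> t4'"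
    using third_neighbour[of t5' t0' t4'] adj adj_sym dist by auto
  obtain g h k l m where t0'_t4: "adj t0' t4" and F0: "on F t4' t0"
    and g: "on g t1 t0'" "on g t1 t0" "on g t0 t5" "on g t5 t4" "on g t4 t0'"
    and h: "on h t3 t4" "on h t3 t4'" "on h t4' t5'" "on h t5' t0'" "on h t4 t0'"
    and k: "on k x t2" "on k t2 t1" "on k t1 t0'" "on k t0' t5'" "on k t5' r'"
    and l: "on l x t2" "on l t2 t3" "on l t3 t4" "on l t4 t5" "on l t5 r"
    and m: "on m r t5" "on m t5 t0" "on m t0 t4'" "on m t4' t5'" "on m t5' r'" and kl: "k \<noteq> l"
    using outer_faces[OF F t0_t4' x r r'] .
  note sym = adj adj[THEN adj_sym] t0_t4' t0'_t4 adj_sym[OF t0_t4'] adj_sym[OF t0'_t4]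
  note rs = r(1) adj_sym[OF r(1)] r'(1) adj_sym[OF r'(1)] x(1) adj_sym[OF x(1)]
  have N0: "adj t0 v \<Longrightarrow> v \<in> {t1, t5, t4'}" for v using adj_fourth[of t0 t1 t5 t4' v] sym dist by auto
  have N0': "adj t0' v \<Longrightarrow> v \<in> {t1, t5', t4}" for v using adj_fourth[of t0' t1 t5' t4 v] sym dist by auto
  have N1: "adj t1 v \<Longrightarrow> v \<in> {t0, t0', t2}" for v using adj_fourth[of t1 t0 t0' t2 v] sym dist by auto
  have N2: "adj t2 v \<Longrightarrow> v \<in> {t1, t3, x}" for v using adj_fourth[of t2 t1 t3 x v] sym rs x dist by auto
  have N3: "adj t3 v \<Longrightarrow> v \<in> {t2, t4, t4'}" for v using adj_fourth[of t3 t2 t4 t4' v] sym dist by auto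
  have N4: "adj t4 v \<Longrightarrow> v \<in> {t3, t5, t0'}" for v using adj_fourth[of t4 t3 t5 t0' v] sym dist by auto
  have N4': "adj t4' v \<Longrightarrow> v \<in> {t3, t5', t0}" for v using adj_fourth[of t4' t3 t5' t0 v] sym dist by auto
  have N5': "adj t5' v \<Longrightarrow> v \<in> {t0', t4', r'}" for v
    using adj_fourth[of t5' t0' t4' r' v] sym rs r' dist by auto
  have r_new: "r \<noteq> t1" "r \<noteq> t3" "r \<noteq> t4'" "r \<noteq> t0'" "r \<noteq> t5"
    using N1[of t5] N3[of t5] N4'[of t5] N0'[of t5] rs adj_irrefl dist by auto
  \<comment> \<open>Otherwise \<open>t5 t5'\<close> is an edge and the distinct faces
    \<open>k\<close> and \<open>l\<close> share \<open>t2\<close>, \<open>t5\<close>,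
    \<open>t5'\<close>.\<close>
  have r5': "r \<noteq> t5'"
  proof
    assume 1: "r = t5'"
    then have "r' = t5" using N5'[of t5] rs dist by auto
    then show False
      using on_meet3[of k t2 x l x t5 t5' t4 t5' t5 t5] 1 kl k l on_sym dist by auto
  qed
  obtain f a b where f: "on f t1 a" "on f a b" "on f b r" and dab: "distinct [t1, a, b, r]"
    using scaffoldE[OF t1_r] .
  have "r = r'"
  proof (rule ccontr)
    assume rr': "r \<noteq> r'"
    \<comment> \<open>Via \<open>t0\<close> the path would lie on \<open>g\<close>, which continues
      from \<open>t5\<close> to \<open>t4\<close> and not to \<open>r\<close>. Via
      \<open>t0'\<close> it cannot reach \<open>r\<close>. Via \<open>t2\<close> it would lie on
      \<open>k\<close>, which would share \<open>t2\<close>, \<open>x\<close>, \<open>r\<close> with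
      \<open>l\<close>.\<close>
    have a: "a = t0 \<or> a = t0' \<or> a = t2" using N1[of a] on_adj[OF f(1)] by auto
    then show False
    proof (elim disjE)
      assume a: "a = t0"
      then have "b = t5 \<or> b = t4'" using N0[of b] on_adj[OF f(2)] dab by auto
      then have "b = t5" using N4'[of r] on_adj[OF f(3)] r_new r5' dab a by auto
      then show False
        using angle_unique[of g t0 t1 t5 f] on_two[of f t5 t0 r t4] a f g on_sym r dist by auto
    next
      assume a: "a = t0'"
      then have "b = t5' \<or> b = t4" using N0'[of b] on_adj[OF f(2)] dab by auto
      then show False
        using N4[of r] N5'[of r] on_adj[OF f(3)] r_new dab a rr' by auto
    next
      assume a: "a = t2"
      then have "b = t3 \<or> b = x" using N2[of b] on_adj[OF f(2)] dab by auto
      then have b: "b = x" using N3[of r] on_adj[OF f(3)] r_new r dab a by auto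
      then have "f = k" using angle_unique[of f t2 t1 x k] f a k on_sym x by auto
      then show False
        using on_meet3[of k t2 x l x x t2 t2 r x t5] kl k l f a b on_sym dab by auto
    qed
  qed
  have "r \<noteq> t2"
    using N2[of t5] N2[of t5'] rs \<open>r = r'\<close> dist by auto
  then have "r = x"
    using on_meet3[of k t2 x l x x t2 t2 r t5' t5] kl k l \<open>r = r'\<close> on_sym x on_irrefl[of _ x]
    by auto
  then show thesis
    using that[of g h k l m] t0'_t4 F0 g h k l m rs \<open>r = r'\<close> r_new r5' r \<open>r \<noteq> t2\<close> by auto
qed

end

section \<open>The pentagons of the Petersen graph\<close>

text \<open>
  The numbers 0 to 9 stand for t0, t0', t1, t2, t3, t4, t4', t5, t5' and the common third neighbour
  of t2, t5, t5'.
\<close>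

definition petersen_nbrs :: "nat \<Rightarrow> nat list" where
  "petersen_nbrs i = [[2, 7, 6], [2, 8, 5], [0, 1, 3], [2, 4, 9], [3, 5, 6],
     [4, 1, 7], [4, 0, 8], [0, 5, 9], [1, 6, 9], [3, 7, 8]] ! i"

text \<open>An explicit isomorphism onto the Kneser graph on two-element subsets of a five-element
  set.\<close>

definition kneser_label :: "nat \<Rightarrow> nat set" where
  "kneser_label i = [{0, 4}, {1, 4}, {2, 3}, {0, 1}, {2, 4},
     {0, 3}, {1, 3}, {1, 2}, {0, 2}, {3, 4}] ! i"

text \<open>The faces \<open>F\<close>, \<open>g\<close>, \<open>h\<close>, \<open>k\<close>,
  \<open>l\<close>, \<open>m\<close> in this order. They form the embedding of the Petersen graph in
  the projective plane.\<close>

definition pentagons :: "nat list list" where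
  "pentagons = [[0, 2, 3, 4, 6], [2, 1, 5, 7, 0], [4, 5, 1, 8, 6],
     [9, 3, 2, 1, 8], [9, 3, 4, 5, 7], [9, 7, 0, 6, 8]]"

definition pentagon_paths :: "nat list list" where
  "pentagon_paths = concat (map (\<lambda>p. map (\<lambda>r.
     [p ! r, p ! ((r + 1) mod 5), p ! ((r + 2) mod 5), p ! ((r + 3) mod 5)]) [0..<5]) pentagons)"

definition nonadjacent_pairs :: "(nat \<times> nat) list" where
  "nonadjacent_pairs = filter (\<lambda>(i, j). i < j \<and> j \<notin> set (petersen_nbrs i))
     (List.product [0..<10] [0..<10])"

section \<open>Finite checks on the ten numbered vertices\<close>

lemma petersen_nbrs_edge:
  "\<forall>i\<in>{..<10}. \<forall>j\<in>set (petersen_nbrs i). j < 10 \<and>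
     (\<exists>p\<in>set pentagons. \<exists>r\<in>{..<5}.
       (i = p ! r \<and> j = p ! (Suc r mod 5)) \<or> (j = p ! r \<and> i = p ! (Suc r mod 5)))"
  unfolding lessThan_atLeast0 set_upt[symmetric] by code_simp

lemma petersen_nbrs_distinct:
  "\<forall>i\<in>{..<10}. distinct (petersen_nbrs i) \<and> length (petersen_nbrs i) = 3 \<and> i \<notin> set (petersen_nbrs i)"
  unfolding lessThan_atLeast0 set_upt[symmetric] by code_simp

text \<open>Every angle begins one of the listed paths or a reversal. As an angle determines its
  face, no further facial paths can exist.\<close>

lemma pentagon_path_through:
  "\<forall>i\<in>{..<10}. \<forall>j\<in>set (petersen_nbrs i). \<forall>k\<in>set (petersen_nbrs i). j \<noteq> k \<longrightarrow>
     (\<exists>q\<in>set (pentagon_paths @ map rev pentagon_paths). take 3 q = [j, i, k])"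
  unfolding lessThan_atLeast0 set_upt[symmetric] by code_simp

lemma pentagon_paths_distinct:
  "\<forall>q\<in>set pentagon_paths. length q = 4 \<and> distinct q \<and> (\<forall>i\<in>set q. i < 10)"
  by code_simp

text \<open>The source of the multiplicity one: the thirty paths have thirty different pairs of
  ends, and these are the non-adjacent pairs. Taking minimum and maximum makes the pairs
  unordered.\<close>

lemma pentagon_paths_ends:
  "distinct (map (\<lambda>q. (min (hd q) (last q), max (hd q) (last q))) pentagon_paths) \<and>
   set (map (\<lambda>q. (min (hd q) (last q), max (hd q) (last q))) pentagon_paths) = set nonadjacent_pairs"
  by code_simp

lemma kneser_label_disjoint:
  "\<forall>i\<in>{..<10}. \<forall>j\<in>{..<10}.
     (kneser_label i \<inter> kneser_label j = {} \<longleftrightarrow> j \<in> set (petersen_nbrs i)) \<and>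
     (kneser_label i = kneser_label j \<longrightarrow> i = j) \<and> kneser_label i \<subseteq> {0, 1, 2, 3, 4} \<and> card (kneser_label i) = 2"
  unfolding lessThan_atLeast0 set_upt[symmetric] by code_simp

lemma kneser_label_surj:
  "\<forall>x\<in>{..<5}. \<forall>y\<in>{..<5}. x \<noteq> y \<longrightarrow> (\<exists>i\<in>{..<10}. kneser_label i = {x, y})"
  unfolding lessThan_atLeast0 set_upt[symmetric] by code_simp

section \<open>Scaffold edges of a polyhedral embedding\<close>

context cubic_polyhedral
begin

text \<open>Degree three gives the axioms on neighbours, the facial cycles those on edges of a face
  at a vertex, \<open>face_through_angle\<close> those on angles, and \<open>faces_meet\<close>
  those on intersections.\<close>

sublocale cubic_faces "\<lambda>u v. (u, v) \<in> parcs G" "\<lambda>f u v. f \<in> faces G \<phi> \<and> {u, v} \<in> f"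
proof (unfold_locales, goal_cases)
  case (1 u v)
  then show ?case by (rule arc_sym)
next
  case (2 v)
  then show ?case using no_loops' by blast
next
  case (3 v a b)
  have "\<not> parcs G `` {v} \<subseteq> {a, b}"
  proof
    assume "parcs G `` {v} \<subseteq> {a, b}"
    then have "card (parcs G `` {v}) \<le> card {a, b}" by (intro card_mono) auto
    also have "\<dots> = 2" using 3 by simp
    finally show False using card_neighbours[OF in_arcsD1[OF 3(1)]] by simp
  qed
  then show ?case by auto
next
  case (4 v a b c d)
  have "finite (parcs G `` {v})"
    using card_neighbours[OF in_arcsD1[OF 4(1)]] card.infinite by fastforce
  moreover have "{a, b, c} \<subseteq> parcs G `` {v}" "card {a, b, c} = 3" using 4 by auto
  ultimately have "{a, b, c} = parcs G `` {v}"
    using card_neighbours[OF in_arcsD1[OF 4(1)]] by (intro card_subset_eq) auto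
  then show ?case using 4(5) by auto
next
  case (5 f u v)
  then show ?case by (simp add: insert_commute)
next
  case (6 f u v)
  then show ?case using face_edge_arc by blast
next
  case (7 f v u)
  then have "{u, v} \<in> f" by (simp add: insert_commute)
  then obtain w where "w \<noteq> u" "\<And>z. {v, z} \<in> f \<longleftrightarrow> z = u \<or> z = w"
    using face_at_vertex[of f u v] 7 by blast
  then show ?case using 7 by blast
next
  case (8 f v a b c)
  then have "{a, v} \<in> f" by (simp add: insert_commute)
  then obtain w where "\<And>z. {v, z} \<in> f \<longleftrightarrow> z = a \<or> z = w"
    using face_at_vertex[of f a v] 8 by blast
  then show ?case using 8 by metis
next
  case (9 v u w)
  then have "\<exists>f. f \<in> faces G \<phi> \<and> {u, v} \<in> f \<and> {v, w} \<in> f"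
    using face_through_angle[of v u w] by blast
  then show ?case by (auto simp: insert_commute)
next
  case (10 f v u w g)
  then have "(v, u) \<in> parcs G" "(v, w) \<in> parcs G" using face_edge_arc by blast+
  then have "\<exists>!f. f \<in> faces G \<phi> \<and> {u, v} \<in> f \<and> {v, w} \<in> f"
    using face_through_angle[of v u w] 10 by blast
  then show ?case using 10 insert_commute[of u v "{}"] by auto
next
  case (11 f a a' g a'' b b' b'')
  then show ?case using faces_meet[of f g a b] by blast
next
  case (12 f a a' g a'' b b' b'' c c' c'')
  show ?case
  proof (rule ccontr)
    assume "f \<noteq> g"
    then have "\<Union> f \<inter> \<Union> g = {a, b}" using faces_meet[of f g a b] 12 by auto
    then show False using 12 by auto
  qed
qed

section \<open>The scaffold multiset in terms of facial paths\<close>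

lemma facial_iff: "facial a b c d \<longleftrightarrow> distinct [a, b, c, d] \<and> facial_subwalk G \<phi> [a, b, c, d]"
  using facial_three_path_iff[of a b c d] by (auto simp: facial_def)

lemma facial_rev: "facial a b c d \<Longrightarrow> facial d c b a"
  unfolding facial_def by (auto simp: insert_commute)

lemma facial_three_paths_eq:
  "facial_three_paths G \<phi> = {{[a, b, c, d], [d, c, b, a]} | a b c d. facial a b c d}"
proof (intro equalityI subsetI)
  fix P assume "P \<in> facial_three_paths G \<phi>"
  then obtain p where p: "P = {p, rev p}" "length p = 4" "distinct p" "facial_subwalk G \<phi> p"
    by (auto simp: facial_three_paths_def)
  then obtain a b c d where "p = [a, b, c, d]"
    by (auto simp: numeral_eq_Suc length_Suc_conv)
  then show "P \<in> {{[a, b, c, d], [d, c, b, a]} | a b c d. facial a b c d}"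
    using p facial_iff by auto
next
  fix P assume "P \<in> {{[a, b, c, d], [d, c, b, a]} | a b c d. facial a b c d}"
  then obtain a b c d where P: "P = {[a, b, c, d], [d, c, b, a]}" and f: "facial a b c d" by auto
  then have "(a, b) \<in> parcs G" "(b, c) \<in> parcs G" "(c, d) \<in> parcs G"
    using on_adj by (auto simp: facial_def)
  then show "P \<in> facial_three_paths G \<phi>"
    unfolding facial_three_paths_def using P f facial_iff
    by (intro CollectI exI[of _ "[a, b, c, d]"]) auto
qed

text \<open>Ensures that \<open>mset_set\<close> does not take its default value, the empty
  multiset.\<close>

lemma finite_facial_three_paths: "finite (facial_three_paths G \<phi>)"
proof (rule finite_subset)
  show "facial_three_paths G \<phi> \<subseteq> (\<lambda>p. {p, rev p}) ` {p. set p \<subseteq> pverts G \<and> length p = 4}"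
  proof
    fix P assume "P \<in> facial_three_paths G \<phi>"
    then obtain a b c d where P: "P = {[a, b, c, d], rev [a, b, c, d]}" and f: "facial a b c d"
      by (auto simp: facial_three_paths_eq)
    then have "(a, b) \<in> parcs G" "(c, d) \<in> parcs G" using on_adj by (auto simp: facial_def)
    then have "set [a, b, c, d] \<subseteq> pverts G" using in_arcsD1 in_arcsD2 by auto
    then show "P \<in> (\<lambda>p. {p, rev p}) ` {p. set p \<subseteq> pverts G \<and> length p = 4}"
      unfolding P by (intro imageI) auto
  qed
  show "finite ((\<lambda>p. {p, rev p}) ` {p. set p \<subseteq> pverts G \<and> length p = 4})"
    by (intro finite_imageI finite_lists_length_eq pair_finite_verts)
qed

lemma scaffold_iff:
  assumes "a \<noteq> d"
  shows "{a, d} \<in># scaffolds (extended_graph G \<phi>) \<longleftrightarrow> scaffold a d"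
proof
  assume "{a, d} \<in># scaffolds (extended_graph G \<phi>)"
  then obtain P where "P \<in> facial_three_paths G \<phi>" "{a, d} = hd ` P"
    by (auto simp: extended_graph_def finite_facial_three_paths)
  then obtain x b c y where "facial x b c y" "{a, d} = {x, y}"
    by (auto simp: facial_three_paths_eq)
  then show "scaffold a d"
    using facial_rev[of x b c y] by (auto simp: scaffold_def doubleton_eq_iff)
next
  assume "scaffold a d"
  then obtain b c where "facial a b c d" by (auto simp: scaffold_def)
  then have "{[a, b, c, d], [d, c, b, a]} \<in> facial_three_paths G \<phi>"
    by (auto simp: facial_three_paths_eq)
  then have "hd ` {[a, b, c, d], [d, c, b, a]} \<in> (\<lambda>P. hd ` P) ` facial_three_paths G \<phi>"
    by (rule imageI)
  then show "{a, d} \<in># scaffolds (extended_graph G \<phi>)"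
    by (simp add: extended_graph_def finite_facial_three_paths)
qed

text \<open>Used to show that no vertices exist beyond the ten labelled ones.\<close>

lemma connected_closed:
  assumes "v \<in> V" "v \<in> pverts G" "\<And>u w. u \<in> V \<Longrightarrow> (u, w) \<in> parcs G \<Longrightarrow> w \<in> V"
  shows "pverts G \<subseteq> V"
proof
  fix w assume w: "w \<in> pverts G"
  have "strongly_connected (mk_symmetric (with_proj G))"
    using embedding by (simp add: embedding_def Digraph_Component.connected_def)
  then have "v \<rightarrow>\<^sup>*\<^bsub>with_proj (mk_symmetric (with_proj G))\<^esub> w"
    using w assms(2) by (auto simp: strongly_connected_def)
  then have "v \<rightarrow>\<^sup>*\<^bsub>with_proj G\<^esub> w"
    using reachable_mk_symmetric_eq[OF sym_arcs] by simp
  then show "w \<in> V"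
  proof (induct rule: reachable_induct)
    case (step x y)
    then show ?case using step assms(3) by blast
  qed (rule assms(1))
qed

end

section \<open>Recognising the Petersen graph and its scaffold edges from six pentagonal
  faces\<close>

locale pentagon_labelling = cubic_polyhedral +
  fixes v :: "nat \<Rightarrow> 'a"
  assumes inj_v: "inj_on v {..<10}"
    and pentagon_face: "p \<in> set pentagons \<Longrightarrow>
      \<exists>f\<in>faces G \<phi>. \<forall>r<5. {v (p ! r), v (p ! (Suc r mod 5))} \<in> f"
begin

lemma v_eq: "i < 10 \<Longrightarrow> j < 10 \<Longrightarrow> v i = v j \<longleftrightarrow> i = j"
  using inj_v by (auto dest: inj_onD)

lemma nbrs_less: "i < 10 \<Longrightarrow> j \<in> set (petersen_nbrs i) \<Longrightarrow> j < 10"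
  using petersen_nbrs_edge by auto

lemma nbrs_arc:
  assumes "i < 10" "j \<in> set (petersen_nbrs i)"
  shows "(v i, v j) \<in> parcs G"
proof -
  obtain p r where "p \<in> set pentagons" "r < 5"
    and ij: "(i = p ! r \<and> j = p ! (Suc r mod 5)) \<or> (j = p ! r \<and> i = p ! (Suc r mod 5))"
    using petersen_nbrs_edge assms by (metis lessThan_iff)
  then obtain f where "f \<in> faces G \<phi>" "{v (p ! r), v (p ! (Suc r mod 5))} \<in> f"
    using pentagon_face by blast
  then have "(v (p ! r), v (p ! (Suc r mod 5))) \<in> parcs G" by (rule face_edge_arc)
  then show ?thesis using ij arc_sym by auto
qed

text \<open>The three neighbours seen on the pentagons already exhaust the degree.\<close>

lemma neighbours_v:
  assumes "i < 10"
  shows "parcs G `` {v i} = v ` set (petersen_nbrs i)"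
proof -
  have "distinct (petersen_nbrs i)" "length (petersen_nbrs i) = 3"
    using petersen_nbrs_distinct assms by auto
  then have l: "card (set (petersen_nbrs i)) = 3" "petersen_nbrs i \<noteq> []"
    by (auto simp: distinct_card)
  have "inj_on v (set (petersen_nbrs i))"
    using inj_on_subset[OF inj_v] nbrs_less[OF assms] by auto
  then have c: "card (v ` set (petersen_nbrs i)) = 3" using l by (simp add: card_image)
  have "v i \<in> pverts G" using l nbrs_arc[OF assms] in_arcsD1 by (meson last_in_set)
  then have 3: "card (parcs G `` {v i}) = 3" by (rule card_neighbours)
  then have "finite (parcs G `` {v i})" using card.infinite by fastforce
  moreover have "v ` set (petersen_nbrs i) \<subseteq> parcs G `` {v i}" using nbrs_arc[OF assms] by auto
  ultimately show ?thesis using c 3 card_subset_eq by metis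
qed

lemma arc_v_iff: "i < 10 \<Longrightarrow> j < 10 \<Longrightarrow> (v i, v j) \<in> parcs G \<longleftrightarrow> j \<in> set (petersen_nbrs i)"
  using neighbours_v[of i] nbrs_arc[of i j] nbrs_less[of i] v_eq by (auto simp: set_eq_iff)

lemma verts_v: "pverts G = v ` {..<10}"
proof
  have arc: "v i \<in> pverts G" if "i < 10" for i
  proof -
    have "length (petersen_nbrs i) = 3" using petersen_nbrs_distinct that by auto
    then have "petersen_nbrs i \<noteq> []" by auto
    then show ?thesis using nbrs_arc[OF that] in_arcsD1 by (meson last_in_set)
  qed
  then show "v ` {..<10} \<subseteq> pverts G" by auto
  show "pverts G \<subseteq> v ` {..<10}"
  proof (rule connected_closed)
    show "v 0 \<in> v ` {..<10}" by simp
    show "v 0 \<in> pverts G" using arc by simp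
    fix u w assume "u \<in> v ` {..<10}" and uw: "(u, w) \<in> parcs G"
    then obtain i where "i < 10" "u = v i" by auto
    then show "w \<in> v ` {..<10}" using neighbours_v[of i] nbrs_less[of i] uw by auto
  qed
qed

lemma iso_petersen: "digraph_iso (with_proj G) (with_proj petersen)"
proof -
  define w where "w = kneser_label \<circ> the_inv_into {..<10} v"
  have w: "w (v i) = kneser_label i" if "i < 10" for i
    using that by (simp add: w_def the_inv_into_f_f[OF inj_v])
  have label_inj: "kneser_label i = kneser_label j \<longleftrightarrow> i = j" if "i < 10" "j < 10" for i j
    using kneser_label_disjoint that by auto
  have label_nbrs: "kneser_label i \<inter> kneser_label j = {} \<longleftrightarrow> j \<in> set (petersen_nbrs i)"
    if "i < 10" "j < 10" for i j
    using kneser_label_disjoint that by auto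
  have w_inj: "inj_on w (pverts G)"
    unfolding verts_v by (rule inj_onI) (auto simp: w label_inj)
  have sets: "{A. A \<subseteq> {..<5} \<and> card A = 2} = kneser_label ` {..<10}"
  proof (intro equalityI subsetI)
    fix A :: "nat set" assume "A \<in> {A. A \<subseteq> {..<5} \<and> card A = 2}"
    then obtain x y where xy: "A = {x, y}" "x \<noteq> y" "x \<in> {..<5}" "y \<in> {..<5}"
      by (auto simp: card_2_iff)
    then obtain i where "i \<in> {..<10}" "kneser_label i = A"
      using kneser_label_surj[rule_format, of x y] by metis
    then show "A \<in> kneser_label ` {..<10}" by (metis imageI)
  next
    fix A assume "A \<in> kneser_label ` {..<10}"
    then obtain i where "i < 10" "A = kneser_label i" by auto
    then have "A \<subseteq> {0, 1, 2, 3, 4}" "card A = 2" using kneser_label_disjoint by auto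
    then show "A \<in> {A. A \<subseteq> {..<5} \<and> card A = 2}" by auto
  qed
  \<comment> \<open>Arcs are ordered pairs, so they are mapped componentwise, with the tail first
    and the head second.\<close>
  let ?iso = "\<lparr>iso_verts = w, iso_arcs = map_prod w w, iso_head = snd, iso_tail = fst\<rparr>"
  have "pre_digraph.digraph_isomorphism (with_proj G) ?iso"
    unfolding pre_digraph.digraph_isomorphism_def
  proof (intro conjI)
    show "wf_digraph (with_proj G)" by unfold_locales
    show "inj_on (iso_verts ?iso) (verts (with_proj G))" using w_inj by simp
    have "parcs G \<subseteq> pverts G \<times> pverts G" using in_arcsD1 in_arcsD2 by auto
    then show "inj_on (iso_arcs ?iso) (arcs (with_proj G))"
      using inj_on_subset[OF map_prod_inj_on[OF w_inj w_inj]] by simp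
  qed auto
  moreover have "with_proj petersen = app_iso ?iso (with_proj G)"
  proof -
    have "pverts petersen = w ` pverts G"
      by (auto simp: petersen_def sets verts_v w image_image)
    moreover have "parcs petersen = map_prod w w ` parcs G"
    proof (intro equalityI subrelI)
      fix A B assume "(A, B) \<in> parcs petersen"
      then have "A \<in> {A. A \<subseteq> {..<5} \<and> card A = 2}" "B \<in> {A. A \<subseteq> {..<5} \<and> card A = 2}"
        and disj: "A \<inter> B = {}"
        by (auto simp: petersen_def)
      then obtain i j where ij: "i < 10" "j < 10" "A = kneser_label i" "B = kneser_label j"
        unfolding sets by blast
      then have ij': "j \<in> set (petersen_nbrs i)" using label_nbrs disj by blast
      from ij have "(A, B) = map_prod w w (v i, v j)" by (simp add: w)
      then show "(A, B) \<in> map_prod w w ` parcs G" using nbrs_arc ij ij' by blast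
    next
      fix A B assume "(A, B) \<in> map_prod w w ` parcs G"
      then obtain x y where xy: "(x, y) \<in> parcs G" "A = w x" "B = w y" by auto
      then obtain i j where ij: "i < 10" "j < 10" "x = v i" "y = v j"
        using verts_v in_arcsD1 in_arcsD2 by blast
      then have "kneser_label i \<inter> kneser_label j = {}" using xy arc_v_iff label_nbrs by simp
      moreover have "kneser_label i \<in> kneser_label ` {..<10}" "kneser_label j \<in> kneser_label ` {..<10}"
        using ij by auto
      ultimately show "(A, B) \<in> parcs petersen"
        using xy ij unfolding sets[symmetric] by (auto simp: petersen_def w)
    qed
    ultimately show ?thesis by (simp add: app_iso_def with_proj_def)
  qed
  ultimately show ?thesis unfolding digraph_iso_def by blast
qed

lemma pentagon_path_facial:
  assumes "q \<in> set pentagon_paths"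
  shows "facial (v (q ! 0)) (v (q ! 1)) (v (q ! 2)) (v (q ! 3))"
proof -
  obtain p r where p: "p \<in> set pentagons" and r: "r < 5"
    and q: "q = [p ! r, p ! ((r + 1) mod 5), p ! ((r + 2) mod 5), p ! ((r + 3) mod 5)]"
    using assms by (auto simp: pentagon_paths_def)
  obtain f where f: "f \<in> faces G \<phi>" "\<And>r. r < 5 \<Longrightarrow> {v (p ! r), v (p ! (Suc r mod 5))} \<in> f"
    using pentagon_face[OF p] by blast
  have "{v (q ! 0), v (q ! 1)} \<in> f" "{v (q ! 1), v (q ! 2)} \<in> f" "{v (q ! 2), v (q ! 3)} \<in> f"
  proof -
    have "Suc r mod 5 = (r + 1) mod 5" "Suc ((r + 1) mod 5) mod 5 = (r + 2) mod 5"
      "Suc ((r + 2) mod 5) mod 5 = (r + 3) mod 5"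
      by (simp_all add: mod_Suc_eq add.commute)
    then show "{v (q ! 0), v (q ! 1)} \<in> f" "{v (q ! 1), v (q ! 2)} \<in> f" "{v (q ! 2), v (q ! 3)} \<in> f"
      using f(2)[OF r] f(2)[of "(r + 1) mod 5"] f(2)[of "(r + 2) mod 5"] by (simp_all add: q)
  qed
  moreover have "distinct [v (q ! 0), v (q ! 1), v (q ! 2), v (q ! 3)]"
    using pentagon_paths_distinct[THEN bspec, OF assms] v_eq by (auto simp: q)
  ultimately show ?thesis using f(1) by (auto simp: facial_def)
qed

text \<open>The first angle \<open>a b c\<close> lies on a listed path. It determines the face, and
  the face has only one other edge at \<open>c\<close>, so the fourth vertex agrees too.\<close>

lemma facial_pentagon_path:
  assumes "facial a b c d"
  obtains q where "q \<in> set pentagon_paths" "[a, b, c, d] = map v q \<or> [a, b, c, d] = map v (rev q)"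
proof -
  obtain f where f: "f \<in> faces G \<phi>" "{a, b} \<in> f" "{b, c} \<in> f" "{c, d} \<in> f" and d: "distinct [a, b, c, d]"
    using assms by (auto simp: facial_def)
  have arcs: "(b, a) \<in> parcs G" "(b, c) \<in> parcs G"
    using face_edge_arc f arc_sym by blast+
  obtain i where i: "i < 10" "b = v i" using arcs in_arcsD1 verts_v by blast
  obtain j k where jk: "j \<in> set (petersen_nbrs i)" "k \<in> set (petersen_nbrs i)" "a = v j" "c = v k"
    using arcs i neighbours_v by blast
  then have "j \<noteq> k" using d by auto
  then obtain q where q: "q \<in> set (pentagon_paths @ map rev pentagon_paths)" "take 3 q = [j, i, k]"
    using pentagon_path_through i jk by (metis lessThan_iff)
  then obtain q' where q': "q' \<in> set pentagon_paths" "q = q' \<or> q = rev q'" by auto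
  have l: "length q' = 4" using pentagon_paths_distinct q' by auto
  obtain l where l: "q = [j, i, k, l]"
  proof -
    have "q = take 3 q @ drop 3 q" "length (drop 3 q) = 1" using l q' by auto
    then show thesis using that q(2) by (metis append_Cons append_Nil length_0_conv length_Suc_conv One_nat_def)
  qed
  have "facial (v j) (v i) (v k) (v l)"
    using pentagon_path_facial[OF q'(1)] q'(2)
  proof (elim disjE)
    assume "facial (v (q' ! 0)) (v (q' ! 1)) (v (q' ! 2)) (v (q' ! 3))" "q = q'"
    then show ?thesis using l by (auto simp: numeral_2_eq_2 numeral_3_eq_3)
  next
    assume f: "facial (v (q' ! 0)) (v (q' ! 1)) (v (q' ! 2)) (v (q' ! 3))" "q = rev q'"
    then have "q' = [l, k, i, j]" using l by (metis rev_rev_ident rev.simps append_Cons append_Nil)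
    then show ?thesis using f facial_rev by (auto simp: numeral_2_eq_2 numeral_3_eq_3)
  qed
  then obtain g where g: "g \<in> faces G \<phi>" "{a, b} \<in> g" "{b, c} \<in> g" "{c, v l} \<in> g" "v l \<noteq> b"
    using jk i by (auto simp: facial_def)
  have "f = g" using angle_unique[of f b a c g] f g d by (auto simp: insert_commute)
  then have "d = v l" using on_two[of f c b d "v l"] f g d by (auto simp: insert_commute)
  then have "[a, b, c, d] = map v q" using l i jk by simp
  then show thesis using that q' by auto
qed

lemma scaffolds_eq:
  "scaffolds (extended_graph G \<phi>) =
    mset_set {{u, w} | u w. u \<in> pverts G \<and> w \<in> pverts G \<and> u \<noteq> w \<and> (u, w) \<notin> parcs G}"
proof -
  define Q where "Q q = {map v q, rev (map v q)}" for q
  define e where "e q = (min (hd q) (last q), max (hd q) (last q))" for q :: "nat list"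
  have paths: "length q = 4" "\<And>i. i \<in> set q \<Longrightarrow> i < 10" if "q \<in> set pentagon_paths" for q
    using pentagon_paths_distinct that by auto
  have img: "facial_three_paths G \<phi> = Q ` set pentagon_paths"
  proof (intro equalityI subsetI)
    fix P assume "P \<in> facial_three_paths G \<phi>"
    then obtain a b c d p where P: "P = {p, rev p}" "p = [a, b, c, d]" and f: "facial a b c d"
      by (auto simp: facial_three_paths_eq)
    obtain q where q: "q \<in> set pentagon_paths" "p = map v q \<or> p = map v (rev q)"
      using facial_pentagon_path[OF f] P(2) by blast
    then have "P = Q q"
      unfolding P(1) Q_def by (elim disjE) (simp_all add: rev_map insert_commute)
    then show "P \<in> Q ` set pentagon_paths" using q(1) by simp
  next
    fix P assume "P \<in> Q ` set pentagon_paths"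
    then obtain q where q: "q \<in> set pentagon_paths" "P = Q q" by auto
    obtain a b c d where abcd: "q = [a, b, c, d]"
      using paths(1)[OF q(1)] by (auto simp: numeral_eq_Suc length_Suc_conv)
    have "facial (v a) (v b) (v c) (v d)"
      using pentagon_path_facial[OF q(1)] abcd by (simp add: numeral_2_eq_2 numeral_3_eq_3)
    then show "P \<in> facial_three_paths G \<phi>"
      unfolding facial_three_paths_eq using q abcd by (auto simp: Q_def)
  qed
  have ends: "hd ` Q q = v ` {hd q, last q}" "hd q < 10" "last q < 10" if "q \<in> set pentagon_paths" for q
  proof -
    have "q \<noteq> []" using paths(1)[OF that] by auto
    then show "hd ` Q q = v ` {hd q, last q}" "hd q < 10" "last q < 10"
      using paths(2)[OF that] by (auto simp: Q_def hd_rev last_map hd_map)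
  qed
  have e_inj: "inj_on e (set pentagon_paths)" and e_img: "e ` set pentagon_paths = set nonadjacent_pairs"
    using pentagon_paths_ends by (auto simp: distinct_map e_def[abs_def])
  \<comment> \<open>Distinct paths have distinct pairs of ends, so forming the image multiset
    creates no multiplicities.\<close>
  have inj: "inj_on (\<lambda>q. hd ` Q q) (set pentagon_paths)"
  proof (rule inj_onI)
    fix q q' assume q: "q \<in> set pentagon_paths" "q' \<in> set pentagon_paths" "hd ` Q q = hd ` Q q'"
    then have "v ` {hd q, last q} = v ` {hd q', last q'}" using ends by simp
    then have "{hd q, last q} = {hd q', last q'}"
      using inj_on_image_eq_iff[OF inj_v] ends q by (metis empty_subsetI insert_subset lessThan_iff)
    then have "e q = e q'" by (auto simp: e_def doubleton_eq_iff min.commute max.commute)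
    then show "q = q'" using e_inj q by (auto dest: inj_onD)
  qed
  have "scaffolds (extended_graph G \<phi>) = image_mset (\<lambda>P. hd ` P) (mset_set (Q ` set pentagon_paths))"
    by (simp add: extended_graph_def img)
  also have "\<dots> = mset_set ((\<lambda>P. hd ` P) ` Q ` set pentagon_paths)"
    using inj by (intro image_mset_mset_set) (auto simp: inj_on_def)
  also have "(\<lambda>P. hd ` P) ` Q ` set pentagon_paths = (\<lambda>(i, j). {v i, v j}) ` e ` set pentagon_paths"
    unfolding image_image using ends
    by (intro image_cong refl) (auto simp: e_def min_def max_def)
  also have "\<dots> = {{u, w} | u w. u \<in> pverts G \<and> w \<in> pverts G \<and> u \<noteq> w \<and> (u, w) \<notin> parcs G}"
    unfolding e_img
  proof (intro equalityI subsetI)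
    fix s assume "s \<in> (\<lambda>(i, j). {v i, v j}) ` set nonadjacent_pairs"
    then obtain i j where "i < j" "i < 10" "j < 10" "j \<notin> set (petersen_nbrs i)" "s = {v i, v j}"
      by (auto simp: nonadjacent_pairs_def)
    then show "s \<in> {{u, w} | u w. u \<in> pverts G \<and> w \<in> pverts G \<and> u \<noteq> w \<and> (u, w) \<notin> parcs G}"
      using v_eq arc_v_iff verts_v by (intro CollectI exI[of _ "v i"] exI[of _ "v j"]) auto
  next
    fix s assume "s \<in> {{u, w} | u w. u \<in> pverts G \<and> w \<in> pverts G \<and> u \<noteq> w \<and> (u, w) \<notin> parcs G}"
    then obtain u w where uw: "s = {u, w}" "u \<in> pverts G" "w \<in> pverts G" "u \<noteq> w" "(u, w) \<notin> parcs G"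
      by blast
    then obtain i j where ij: "u = v i" "w = v j" "i < 10" "j < 10" unfolding verts_v by auto
    have "(i, j) \<in> set nonadjacent_pairs \<or> (j, i) \<in> set nonadjacent_pairs"
    proof -
      have "i \<noteq> j" "j \<notin> set (petersen_nbrs i)" "i \<notin> set (petersen_nbrs j)"
        using uw ij arc_v_iff arc_sym[of "v j" "v i"] by auto
      then show ?thesis using ij by (auto simp: nonadjacent_pairs_def)
    qed
    then show "s \<in> (\<lambda>(i, j). {v i, v j}) ` set nonadjacent_pairs"
      using uw ij by (force simp: insert_commute)
  qed
  finally show ?thesis .
qed

end

section \<open>From the butterfly to the labelled pentagons\<close>

context cubic_polyhedral
begin

lemma butterfly_faces:
  assumes "butterfly_one (extended_graph G \<phi>) t0 t0' t1 t2 t3 t4 t4' t5 t5'"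
  shows "butterfly_faces (\<lambda>u v. (u, v) \<in> parcs G) (\<lambda>f u v. f \<in> faces G \<phi> \<and> {u, v} \<in> f)
    t0 t0' t1 t2 t3 t4 t4' t5 t5'"
proof unfold_locales
  show d: "distinct [t0, t0', t1, t2, t3, t4, t4', t5, t5']"
    using assms by (simp add: butterfly_one_def)
  have hexagon: "(a, b) \<in> parcs G \<and> (b, c) \<in> parcs G \<and> (c, d) \<in> parcs G \<and> (d, e) \<in> parcs G \<and>
      (e, f) \<in> parcs G \<and> (f, a) \<in> parcs G"
    if "vertex_cycle (extended_graph G \<phi>) [a, b, c, d, e, f]" for a b c d e f
  proof -
    have "([a, b, c, d, e, f] ! i, [a, b, c, d, e, f] ! (Suc i mod 6)) \<in> parcs G" if "i < 6" for i
      using \<open>vertex_cycle _ _\<close> that by (auto simp: vertex_cycle_def extended_graph_def)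
    from this[of 0] this[of 1] this[of 2] this[of 3] this[of 4] this[of 5] show ?thesis by simp
  qed
  have "vertex_cycle (extended_graph G \<phi>) [t0, t1, t2, t3, t4, t5]"
    "vertex_cycle (extended_graph G \<phi>) [t0', t1, t2, t3, t4', t5']"
    using assms by (simp_all add: butterfly_one_def)
  from this[THEN hexagon]
show "(t1, t0) \<in> parcs G" "(t1, t0') \<in> parcs G" "(t1, t2) \<in> parcs G" "(t2, t3) \<in> parcs G"
    "(t3, t4) \<in> parcs G" "(t3, t4') \<in> parcs G" "(t4, t5) \<in> parcs G" "(t4', t5') \<in> parcs G"
    "(t5, t0) \<in> parcs G" "(t5', t0') \<in> parcs G"
    using arc_sym by blast+
  show "scaffold t1 t4" "scaffold t1 t4'" "scaffold t3 t0" "scaffold t3 t0'"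
    using assms d scaffold_iff[of t1 t4] scaffold_iff[of t1 t4'] scaffold_iff[of t3 t0]
      scaffold_iff[of t3 t0']
    by (auto simp: butterfly_one_def insert_commute)
qed

end

lemma butterfly_one_swap:
  "butterfly_one X t0 t0' t1 t2 t3 t4 t4' t5 t5' \<Longrightarrow> butterfly_one X t0' t0 t1 t2 t3 t4' t4 t5' t5"
  by (auto simp: butterfly_one_def)

theorem theorem16:
  fixes G :: "'a pair_pre_digraph" and \<phi> :: "'a scheme"
    and t0 t0' t1 t2 t3 t4 t4' t5 t5' :: 'a
  assumes "pair_graph G"
    and "cubic G"
    and "polyhedral G \<phi>"
    and "butterfly_one (extended_graph G \<phi>) t0 t0' t1 t2 t3 t4 t4' t5 t5'"
    and "fork (extended_graph G \<phi>) t1 t2 t3 t4 t4'"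
    and "\<not> disjunction_solvable G (extended_graph G \<phi>) t1 t2 t3 t4 t4'"
    and "fork (extended_graph G \<phi>) t3 t2 t1 t0 t0'"
    and "\<not> disjunction_solvable G (extended_graph G \<phi>) t3 t2 t1 t0 t0'"
  shows "digraph_iso (with_proj G) (with_proj petersen) \<and>
    scaffolds (extended_graph G \<phi>) =
      mset_set {{u, v} | u v. u \<in> pverts G \<and> v \<in> pverts G \<and> u \<noteq> v \<and> (u, v) \<notin> parcs G}"
proof -
  \<comment> \<open>Unsolvability supplies an embedding avoiding each of the two paths of the fork
    at \<open>t1\<close>; since some path must be facial, each embedding uses the other one.\<close>
  obtain \<psi> \<chi> where \<psi>: "polyhedral G \<psi>" "extended_graph G \<psi> = extended_graph G \<phi>"
      "\<not> facial_subwalk G \<psi> [t1, t2, t3, t4]"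
    and \<chi>: "polyhedral G \<chi>" "extended_graph G \<chi> = extended_graph G \<phi>"
      "\<not> facial_subwalk G \<chi> [t1, t2, t3, t4']"
    using assms(6) unfolding disjunction_solvable_def by blast
  interpret \<psi>: cubic_polyhedral G \<psi>
    using assms(1,2) \<psi>(1) by (intro cubic_polyhedral.intro cubic_polyhedral_axioms.intro)
  interpret \<chi>: cubic_polyhedral G \<chi>
    using assms(1,2) \<chi>(1) by (intro cubic_polyhedral.intro cubic_polyhedral_axioms.intro)
  interpret \<psi>: butterfly_faces "\<lambda>u v. (u, v) \<in> parcs G" "\<lambda>f u v. f \<in> faces G \<psi> \<and> {u, v} \<in> f"
      t0 t0' t1 t2 t3 t4 t4' t5 t5'
    using \<psi>.butterfly_faces assms(4) \<psi>(2) by simp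
  \<comment> \<open>Primed and unprimed vertices are exchanged, so that \<chi> is of the same
    crossing kind as \<psi> and the same lemmas apply.\<close>
  interpret \<chi>: butterfly_faces "\<lambda>u v. (u, v) \<in> parcs G" "\<lambda>f u v. f \<in> faces G \<chi> \<and> {u, v} \<in> f"
      t0' t0 t1 t2 t3 t4' t4 t5' t5
    using \<chi>.butterfly_faces[OF butterfly_one_swap] assms(4) \<chi>(2) by simp
  have "distinct [t1, t2, t3, t4, t4']" using \<psi>.dist by auto
  then have "\<psi>.facial t1 t2 t3 t4'" "\<chi>.facial t1 t2 t3 t4"
    using \<psi>.facial_cases[of t1 t2 t3 t4 t4'] \<chi>.facial_cases[of t1 t2 t3 t4 t4'] \<psi>.adj
      \<psi>.facial_iff \<chi>.facial_iff \<psi>(3) \<chi>(3)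
    by auto
  obtain F where F: "F \<in> faces G \<psi> \<and> {t0, t1} \<in> F" "F \<in> faces G \<psi> \<and> {t1, t2} \<in> F"
      "F \<in> faces G \<psi> \<and> {t2, t3} \<in> F" "F \<in> faces G \<psi> \<and> {t3, t4'} \<in> F"
    using \<psi>.facial_crossing[OF \<open>\<psi>.facial t1 t2 t3 t4'\<close>] .
  obtain F' where F': "F' \<in> faces G \<chi> \<and> {t0', t1} \<in> F'" "F' \<in> faces G \<chi> \<and> {t1, t2} \<in> F'"
      "F' \<in> faces G \<chi> \<and> {t2, t3} \<in> F'" "F' \<in> faces G \<chi> \<and> {t3, t4} \<in> F'"
    using \<chi>.facial_crossing[OF \<open>\<chi>.facial t1 t2 t3 t4\<close>] .
  have t0'_t4: "(t0', t4) \<in> parcs G" using \<psi>.pentagons[OF F] by blast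
  have t0_t4': "(t0, t4') \<in> parcs G" using \<chi>.pentagons[OF F'] by blast
  obtain r where r: "(t5, r) \<in> parcs G" "r \<noteq> t0" "r \<noteq> t4"
    using \<psi>.third_neighbour[of t5 t0 t4] \<psi>.adj \<psi>.adj_sym \<psi>.dist by auto
  \<comment> \<open>In the exchanged labelling \<open>t5\<close> takes the role of
    \<open>t5'\<close>, so \<chi> yields the scaffold edge from \<open>t1\<close> to the third
    neighbour of \<open>t5\<close>. The common extended graph transfers it to \<psi>.\<close>
  have "\<chi>.scaffold t1 r" by (rule \<chi>.scaffold_third[OF F' t0'_t4 r])
  moreover have "t1 \<noteq> r" using calculation \<chi>.scaffoldE by force
  ultimately have t1_r: "\<psi>.scaffold t1 r"
    using \<psi>.scaffold_iff \<chi>.scaffold_iff \<psi>(2) \<chi>(2) by simp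
  obtain g h k l m where r_new: "r \<notin> {t0, t0', t1, t2, t3, t4, t4', t5, t5'}"
    and faces: "{F, g, h, k, l, m} \<subseteq> faces G \<psi>" "{t4', t0} \<in> F"
    "{t1, t0'} \<in> g" "{t1, t0} \<in> g" "{t0, t5} \<in> g" "{t5, t4} \<in> g" "{t4, t0'} \<in> g"
    "{t3, t4} \<in> h" "{t3, t4'} \<in> h" "{t4', t5'} \<in> h" "{t5', t0'} \<in> h" "{t4, t0'} \<in> h"
    "{r, t2} \<in> k" "{t2, t1} \<in> k" "{t1, t0'} \<in> k" "{t0', t5'} \<in> k" "{t5', r} \<in> k"
    "{r, t2} \<in> l" "{t2, t3} \<in> l" "{t3, t4} \<in> l" "{t4, t5} \<in> l" "{t5, r} \<in> l"
    "{r, t5} \<in> m" "{t5, t0} \<in> m" "{t0, t4'} \<in> m" "{t4', t5'} \<in> m" "{t5', r} \<in> m"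
  proof (rule \<psi>.petersen_faces[OF F t0_t4' r t1_r], goal_cases)
    case (1 g h k l m)
    show thesis by (rule that[of g h k l m]) (use 1 F(1) in simp_all)
  qed
  define v where "v i = [t0, t0', t1, t2, t3, t4, t4', t5, t5', r] ! i" for i
  interpret pentagon_labelling G \<psi> v
  proof unfold_locales
    have "distinct [t0, t0', t1, t2, t3, t4, t4', t5, t5', r]" using \<psi>.dist r_new by auto
    then show "inj_on v {..<10}" unfolding v_def by (intro inj_on_nth) auto
  next
    have pentagon: "\<forall>i<5. {v ([a, b, c, d, e] ! i), v ([a, b, c, d, e] ! (Suc i mod 5))} \<in> f"
      if "{v a, v b} \<in> f" "{v b, v c} \<in> f" "{v c, v d} \<in> f" "{v d, v e} \<in> f" "{v e, v a} \<in> f"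
      for a b c d e f
    proof (intro allI impI)
      fix i :: nat assume "i < 5"
      then consider "i = 0" | "i = 1" | "i = 2" | "i = 3" | "i = 4" by linarith
      then show "{v ([a, b, c, d, e] ! i), v ([a, b, c, d, e] ! (Suc i mod 5))} \<in> f"
        using that by cases simp_all
    qed
    have v: "v 0 = t0" "v 1 = t0'" "v 2 = t1" "v 3 = t2" "v 4 = t3" "v 5 = t4" "v 6 = t4'"
      "v 7 = t5" "v 8 = t5'" "v 9 = r"
      by (simp_all add: v_def)
    fix p assume "p \<in> set pentagons"
    then consider "p = [0, 2, 3, 4, 6]" | "p = [2, 1, 5, 7, 0]" | "p = [4, 5, 1, 8, 6]" |
      "p = [9, 3, 2, 1, 8]" | "p = [9, 3, 4, 5, 7]" | "p = [9, 7, 0, 6, 8]"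
      by (auto simp: pentagons_def)
    then show "\<exists>f\<in>faces G \<psi>. \<forall>r<5. {v (p ! r), v (p ! (Suc r mod 5))} \<in> f"
    proof cases
      case 1
      have "\<forall>r<5. {v (p ! r), v (p ! (Suc r mod 5))} \<in> F"
        unfolding 1 by (rule pentagon; unfold v; use F faces in \<open>simp add: insert_commute\<close>)
      then show ?thesis using faces(1) by blast
    next
      case 2
      have "\<forall>r<5. {v (p ! r), v (p ! (Suc r mod 5))} \<in> g"
        unfolding 2 by (rule pentagon; unfold v; use faces in \<open>simp add: insert_commute\<close>)
      then show ?thesis using faces(1) by blast
    next
      case 3
      have "\<forall>r<5. {v (p ! r), v (p ! (Suc r mod 5))} \<in> h"
        unfolding 3 by (rule pentagon; unfold v; use faces in \<open>simp add: insert_commute\<close>)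
      then show ?thesis using faces(1) by blast
    next
      case 4
      have "\<forall>r<5. {v (p ! r), v (p ! (Suc r mod 5))} \<in> k"
        unfolding 4 by (rule pentagon; unfold v; use faces in \<open>simp add: insert_commute\<close>)
      then show ?thesis using faces(1) by blast
    next
      case 5
      have "\<forall>r<5. {v (p ! r), v (p ! (Suc r mod 5))} \<in> l"
        unfolding 5 by (rule pentagon; unfold v; use faces in \<open>simp add: insert_commute\<close>)
      then show ?thesis using faces(1) by blast
    next
      case 6
      have "\<forall>r<5. {v (p ! r), v (p ! (Suc r mod 5))} \<in> m"
        unfolding 6 by (rule pentagon; unfold v; use faces in \<open>simp add: insert_commute\<close>)
      then show ?thesis using faces(1) by blast
    qed
  qed
  \<comment> \<open>The labelling was found for \<psi>, whose extended graph equals that of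
    \<phi>.\<close>
  show ?thesis using iso_petersen scaffolds_eq \<psi>(2) by simp
qed

end
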